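(* Let $\{G_i,h^i_j,J\}$ and $\{X_i,p^i_j,J\}$ be inverse mapping systems of groups $G_j$ and topological spaces $X_j$, with $G_j$ acting on $X_j$, where $h^i_j:G_i\to G_j$ are group homomorphisms and $p^i_j:X_i\to X_j$ are continuous mappings for each $i\ge j$ in a directed set $J$. Let a topological space $X$ be homeomorphic with $\lim\{X_j,p^i_j,J\}$, and let $G=\lim\{G_j,h^i_j,J\}$ act on $X$ compatibly with these systems. For each $i\in J$ let $$PQ^+_\sigma(X_i,\mathbf F,\mathcal B_i,G_i):=\{m_i:\ m_i\in Q^+_\sigma(X_i,\mathbf F,\mathcal B_i,G_i),\ m_i(X_i)=1\},\quad \mathcal B_i=\mathcal B(X_i),$$ and define $PQ^+_\sigma(X,\mathbf F,\mathcal B,G)$ analogously. Let $(X_i,\mathcal B_i)$ be a Radon space for each $i\in J$. If $J$ is countable, then there exists an embedding of $PQ^+_\sigma(X,\mathbf F,\mathcal B,G)$ into $\lim\{PQ^+_\sigma(X_i,\mathbf F,\mathcal B_i,G_i);h^i_j;p^i_j;J\}$ relative to the weak topology $\tau_w(G)$ on the former and the inverse limit topology $\{\tau_w(G_i);p^i_j;h^i_j;J\}$ on the latter.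
   Context: All spaces are Tychonoff; $\mathbf F$ is $\mathbf R$ or $\mathbf C$. For a space $Y$, $C_b(Y,\mathbf F)$ is the space of bounded continuous functions; $\mathcal F(Y)$ (resp. $\mathcal B(Y)$) is the smallest algebra (resp. $\sigma$-algebra) of subsets containing all zero sets $f^{-1}(0)$, $f\in C_b(Y,\mathbf R)$, and their complements; $\mathcal B=\mathcal B(X)$. A group $H$ acts on $Y$ by maps with $g(jx)=(gj)x$, $ex=x$; standing assumption: each $g\in H$ maps $\mathcal F(Y)$ into $\mathcal F(Y)$ and $gY=Y$. $Q^+_\sigma(Y,\mathbf F,\mathcal B(Y),H)$ is the set of non-negative finite $\sigma$-smooth measures $m$ (countably additive on $\mathcal B(Y)$) that are quasi-invariant relative to $H$: for each $g\in H$, $m^g(A):=m(g^{-1}A)$ has the same null sets as $m$. $(Y,\mathcal B(Y))$ is a Radon space if every finite non-negative countably additive measure on $\mathcal B(Y)$ is Radon (inner regular with respect to compact sets). $\tau_w(H)$ is the topology with base of neighborhoods $\{m:\ |\int f_r\,dm^{g(l)}-\int f_r\,dm_0^{g(l)}|<y,\ r\le n,\ l\le k\}$, $f_r\in C_b(Y,\mathbf F)$, $g(l)\in H$, $y>0$. $p^i:X\to X_i$ and $h^i:G\to G_i$ are the canonical projections, $p^i_j\circ p^i=p^j$, $h^i_j\circ h^i=h^j$; compatibility means $p^i(gx)=h^i(g)p^i(x)$ and $p^i_j(g_ix_i)=h^i_j(g_i)p^i_j(x_i)$. $\lim\{PQ^+_\sigma(X_i,\mathbf F,\mathcal B_i,G_i);h^i_j;p^i_j;J\}$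 is the set of families $(m_i)_{i\in J}$ with $m_i\in PQ^+_\sigma(X_i,\mathbf F,\mathcal B_i,G_i)$ and $m_i((p^i_j)^{-1}(B))=m_j(B)$ for $i\ge j$, $B\in\mathcal B_j$, with the topology induced from the product of the spaces carrying $\tau_w(G_i)$. An embedding is a homeomorphism onto its image.
   Formalization: The formal theorem additionally assumes that each canonical projection h^i: G → G_i is onto; without this the claim is false, since the limit of the spaces PQ(X_i, G_i) can be empty while PQ(X, G) is not. *)

theory Defs
  imports "HOL-Analysis.Analysis" "HOL-Algebra.Group_Action" "HOL-Algebra.Product_Groups"
begin

section \<open>Zero sets and the Baire sigma-algebra\<close>

definition Tychonoff_space :: "'a topology \<Rightarrow> bool" where
  "Tychonoff_space Y \<longleftrightarrow> completely_regular_space Y \<and> Hausdorff_space Y"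

text \<open>The scalar field is a subset \<open>F\<close> of the complex numbers, either \<open>\<real>\<close> or \<open>UNIV\<close>, so that one
  definition covers real-valued and complex-valued functions. Values off \<open>topspace Y\<close> are
  irrelevant.\<close>

definition Cb :: "'a topology \<Rightarrow> complex set \<Rightarrow> ('a \<Rightarrow> complex) set" where
  "Cb Y F = {f. continuous_map Y euclidean f \<and> bounded (f ` topspace Y) \<and> f ` topspace Y \<subseteq> F}"

definition zero_sets :: "'a topology \<Rightarrow> 'a set set" where
  "zero_sets Y = (\<lambda>f. {x \<in> topspace Y. f x = 0}) ` Cb Y \<real>"

definition zero_set_algebra :: "'a topology \<Rightarrow> 'a set set" where
  "zero_set_algebra Y = \<Inter>{\<A>. algebra (topspace Y) \<A> \<and> zero_sets Y \<subseteq> \<A>}"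

definition baire :: "'a topology \<Rightarrow> 'a measure" where
  "baire Y = sigma (topspace Y) (zero_sets Y)"

section \<open>Radon spaces\<close>

text \<open>A compact set of a Tychonoff space need not be a Baire set, hence the outer measure; on
  compact Baire sets it is the measure itself.\<close>

definition radon_measure :: "'a topology \<Rightarrow> 'a measure \<Rightarrow> bool" where
  "radon_measure Y m \<longleftrightarrow>
     (\<forall>A\<in>sets m. emeasure m A = (SUP K\<in>{K. compactin Y K \<and> K \<subseteq> A}. outer_measure_of m K))"

definition radon_space :: "'a topology \<Rightarrow> bool" where
  "radon_space Y \<longleftrightarrow>
     (\<forall>m. finite_measure m \<and> sets m = sets (baire Y) \<longrightarrow> radon_measure Y m)"

section \<open>Group actions and quasi-invariant measures\<close>

definition admissible_action ::
    "('g, 'm) monoid_scheme \<Rightarrow> 'a topology \<Rightarrow> ('g \<Rightarrow> 'a \<Rightarrow> 'a) \<Rightarrow> bool" where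
  "admissible_action H Y a \<longleftrightarrow>
     group_action H (topspace Y) a \<and>
     (\<forall>g\<in>carrier H. a g ` topspace Y = topspace Y \<and>
        (\<forall>A\<in>zero_set_algebra Y. a g ` A \<in> zero_set_algebra Y))"

text \<open>The measure \<open>m\<^sup>g\<close>, whose value at \<open>A\<close> is \<open>m (g\<^sup>-\<^sup>1 A)\<close>: since \<open>g\<close> acts as a bijection,
  \<open>g\<^sup>-\<^sup>1 A\<close> is the preimage of \<open>A\<close> under \<open>a g\<close>.\<close>

definition translate :: "('g \<Rightarrow> 'a \<Rightarrow> 'a) \<Rightarrow> 'g \<Rightarrow> 'a measure \<Rightarrow> 'a measure" where
  "translate a g m = distr m m (a g)"

definition Qplus ::
    "'a topology \<Rightarrow> ('g, 'm) monoid_scheme \<Rightarrow> ('g \<Rightarrow> 'a \<Rightarrow> 'a) \<Rightarrow> 'a measure set" where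
  "Qplus Y H a =
     {m. finite_measure m \<and> sets m = sets (baire Y) \<and>
         (\<forall>g\<in>carrier H. null_sets (translate a g m) = null_sets m)}"

definition PQplus ::
    "'a topology \<Rightarrow> ('g, 'm) monoid_scheme \<Rightarrow> ('g \<Rightarrow> 'a \<Rightarrow> 'a) \<Rightarrow> 'a measure set" where
  "PQplus Y H a = {m \<in> Qplus Y H a. emeasure m (topspace Y) = 1}"

section \<open>The weak topology\<close>

definition weak_nbhd ::
    "'a topology \<Rightarrow> ('g, 'm) monoid_scheme \<Rightarrow> ('g \<Rightarrow> 'a \<Rightarrow> 'a) \<Rightarrow> 'a measure \<Rightarrow>
     ('a \<Rightarrow> complex) set \<Rightarrow> 'g set \<Rightarrow> real \<Rightarrow> 'a measure set" where
  "weak_nbhd Y H a m0 \<Phi> L y =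
     {m \<in> Qplus Y H a. \<forall>f\<in>\<Phi>. \<forall>g\<in>L.
        cmod ((\<integral>x. f x \<partial>translate a g m) - (\<integral>x. f x \<partial>translate a g m0)) < y}"

definition weak_open ::
    "complex set \<Rightarrow> 'a topology \<Rightarrow> ('g, 'm) monoid_scheme \<Rightarrow> ('g \<Rightarrow> 'a \<Rightarrow> 'a) \<Rightarrow>
     'a measure set \<Rightarrow> bool" where
  "weak_open F Y H a U \<longleftrightarrow> U \<subseteq> Qplus Y H a \<and>
     (\<forall>m0\<in>U. \<exists>\<Phi> L y. finite \<Phi> \<and> \<Phi> \<subseteq> Cb Y F \<and> finite L \<and> L \<subseteq> carrier H \<and> 0 < y \<and>
        weak_nbhd Y H a m0 \<Phi> L y \<subseteq> U)"

definition tau_w ::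
    "complex set \<Rightarrow> 'a topology \<Rightarrow> ('g, 'm) monoid_scheme \<Rightarrow> ('g \<Rightarrow> 'a \<Rightarrow> 'a) \<Rightarrow>
     'a measure topology" where
  "tau_w F Y H a = topology (weak_open F Y H a)"

lemma weak_openD:
  assumes "weak_open F Y H a U" "m0 \<in> U"
  obtains \<Phi> L y where "finite \<Phi>" "\<Phi> \<subseteq> Cb Y F" "finite L" "L \<subseteq> carrier H" "0 < y"
    "weak_nbhd Y H a m0 \<Phi> L y \<subseteq> U"
proof -
  have "\<exists>\<Phi> L y. finite \<Phi> \<and> \<Phi> \<subseteq> Cb Y F \<and> finite L \<and> L \<subseteq> carrier H \<and> 0 < y \<and>
        weak_nbhd Y H a m0 \<Phi> L y \<subseteq> U"
    using assms unfolding weak_open_def by (elim conjE) (drule (1) bspec)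
  then show thesis
    by (elim exE conjE) (rule that)
qed

lemma weak_openI:
  assumes "U \<subseteq> Qplus Y H a"
    and "\<And>m0. m0 \<in> U \<Longrightarrow> \<exists>\<Phi> L y. finite \<Phi> \<and> \<Phi> \<subseteq> Cb Y F \<and> finite L \<and> L \<subseteq> carrier H \<and> 0 < y \<and>
        weak_nbhd Y H a m0 \<Phi> L y \<subseteq> U"
  shows "weak_open F Y H a U"
  unfolding weak_open_def using assms by (intro conjI ballI)

lemma weak_nbhd_mono:
  assumes "\<Phi> \<subseteq> \<Phi>'" "L \<subseteq> L'" "y' \<le> y"
  shows "weak_nbhd Y H a m0 \<Phi>' L' y' \<subseteq> weak_nbhd Y H a m0 \<Phi> L y"
proof
  fix m assume m: "m \<in> weak_nbhd Y H a m0 \<Phi>' L' y'"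
  have "cmod ((\<integral>x. f x \<partial>translate a g m) - (\<integral>x. f x \<partial>translate a g m0)) < y"
    if "f \<in> \<Phi>" "g \<in> L" for f g
  proof -
    have "f \<in> \<Phi>'" "g \<in> L'" using that assms(1,2) by (simp_all add: subset_iff)
    then have "cmod ((\<integral>x. f x \<partial>translate a g m) - (\<integral>x. f x \<partial>translate a g m0)) < y'"
      using m by (simp add: weak_nbhd_def)
    then show ?thesis using assms(3) by (rule less_le_trans)
  qed
  then show "m \<in> weak_nbhd Y H a m0 \<Phi> L y"
    using m by (simp add: weak_nbhd_def)
qed

lemma istopology_weak_open: "istopology (weak_open F Y H a)"
  unfolding istopology_def
proof (intro conjI allI impI)
  fix S T assume S: "weak_open F Y H a S" and T: "weak_open F Y H a T"
  show "weak_open F Y H a (S \<inter> T)"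
  proof (rule weak_openI)
    have "S \<subseteq> Qplus Y H a" using S by (simp add: weak_open_def)
    then show "S \<inter> T \<subseteq> Qplus Y H a" by (rule le_infI1)
    fix m0 assume "m0 \<in> S \<inter> T"
    then have m0: "m0 \<in> S" "m0 \<in> T" by simp_all
    obtain \<Phi>1 L1 y1 where 1: "finite \<Phi>1" "\<Phi>1 \<subseteq> Cb Y F" "finite L1" "L1 \<subseteq> carrier H" "0 < y1"
        "weak_nbhd Y H a m0 \<Phi>1 L1 y1 \<subseteq> S"
      using weak_openD[OF S m0(1)] .
    obtain \<Phi>2 L2 y2 where 2: "finite \<Phi>2" "\<Phi>2 \<subseteq> Cb Y F" "finite L2" "L2 \<subseteq> carrier H" "0 < y2"
        "weak_nbhd Y H a m0 \<Phi>2 L2 y2 \<subseteq> T"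
      using weak_openD[OF T m0(2)] .
    let ?N = "weak_nbhd Y H a m0 (\<Phi>1 \<union> \<Phi>2) (L1 \<union> L2) (min y1 y2)"
    have "?N \<subseteq> S" by (rule order_trans[OF weak_nbhd_mono 1(6)]) simp_all
    moreover have "?N \<subseteq> T" by (rule order_trans[OF weak_nbhd_mono 2(6)]) simp_all
    ultimately show "\<exists>\<Phi> L y. finite \<Phi> \<and> \<Phi> \<subseteq> Cb Y F \<and> finite L \<and> L \<subseteq> carrier H \<and> 0 < y \<and>
        weak_nbhd Y H a m0 \<Phi> L y \<subseteq> S \<inter> T"
      using 1(1-5) 2(1-5)
      by (intro exI[of _ "\<Phi>1 \<union> \<Phi>2"] exI[of _ "L1 \<union> L2"] exI[of _ "min y1 y2"]) simp
  qed
next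
  fix K assume K: "\<forall>U\<in>K. weak_open F Y H a U"
  show "weak_open F Y H a (\<Union>K)"
  proof (rule weak_openI)
    show "\<Union>K \<subseteq> Qplus Y H a" using K by (intro Union_least) (simp add: weak_open_def)
    fix m0 assume "m0 \<in> \<Union>K"
    then obtain U where U: "U \<in> K" "m0 \<in> U" by (rule UnionE)
    obtain \<Phi> L y where N: "finite \<Phi>" "\<Phi> \<subseteq> Cb Y F" "finite L" "L \<subseteq> carrier H" "0 < y"
        "weak_nbhd Y H a m0 \<Phi> L y \<subseteq> U"
      using weak_openD[OF bspec[OF K U(1)] U(2)] .
    show "\<exists>\<Phi> L y. finite \<Phi> \<and> \<Phi> \<subseteq> Cb Y F \<and> finite L \<and> L \<subseteq> carrier H \<and> 0 < y \<and>
        weak_nbhd Y H a m0 \<Phi> L y \<subseteq> \<Union>K"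
      using N(1-5) order_trans[OF N(6) Union_upper[OF U(1)]] by (intro exI conjI)
  qed
qed

lemma openin_tau_w: "openin (tau_w F Y H a) = weak_open F Y H a"
  unfolding tau_w_def by (rule topology_inverse'[OF istopology_weak_open])

lemma topspace_tau_w: "topspace (tau_w F Y H a) = Qplus Y H a"
proof -
  have "weak_open F Y H a (Qplus Y H a)"
  proof (rule weak_openI)
    fix m0
    have "weak_nbhd Y H a m0 {} {} 1 \<subseteq> Qplus Y H a"
      by (simp add: weak_nbhd_def)
    then show "\<exists>\<Phi> L y. finite \<Phi> \<and> \<Phi> \<subseteq> Cb Y F \<and> finite L \<and> L \<subseteq> carrier H \<and> 0 < y \<and>
        weak_nbhd Y H a m0 \<Phi> L y \<subseteq> Qplus Y H a"
      by (intro exI[of _ "{}"] exI[of _ "1::real"]) simp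
  qed simp
  then show ?thesis
    unfolding topspace_def openin_tau_w by (intro antisym Union_least Union_upper) (simp_all add: weak_open_def)
qed

definition PQ_space ::
    "complex set \<Rightarrow> 'a topology \<Rightarrow> ('g, 'm) monoid_scheme \<Rightarrow> ('g \<Rightarrow> 'a \<Rightarrow> 'a) \<Rightarrow>
     'a measure topology" where
  "PQ_space F Y H a = subtopology (tau_w F Y H a) (PQplus Y H a)"

section \<open>Inverse systems\<close>

definition directed_set :: "'i set \<Rightarrow> ('i \<Rightarrow> 'i \<Rightarrow> bool) \<Rightarrow> bool" where
  "directed_set J leq \<longleftrightarrow> reflp_on J leq \<and> transp_on J leq \<and>
     (\<forall>i\<in>J. \<forall>j\<in>J. \<exists>k\<in>J. leq i k \<and> leq j k)"

text \<open>The bonding map \<open>p i j\<close> goes from the \<open>i\<close>-th to the \<open>j\<close>-th object, for \<open>i \<ge> j\<close>.\<close>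

definition inverse_system_sets ::
    "'i set \<Rightarrow> ('i \<Rightarrow> 'i \<Rightarrow> bool) \<Rightarrow> ('i \<Rightarrow> 'a set) \<Rightarrow> ('i \<Rightarrow> 'i \<Rightarrow> 'a \<Rightarrow> 'a) \<Rightarrow> bool" where
  "inverse_system_sets J leq S p \<longleftrightarrow>
     (\<forall>i\<in>J. \<forall>j\<in>J. leq j i \<longrightarrow> p i j \<in> S i \<rightarrow> S j) \<and>
     (\<forall>i\<in>J. \<forall>x\<in>S i. p i i x = x) \<and>
     (\<forall>i\<in>J. \<forall>j\<in>J. \<forall>k\<in>J. leq j i \<longrightarrow> leq k j \<longrightarrow> (\<forall>x\<in>S i. p j k (p i j x) = p i k x))"

definition inverse_system_spaces ::
    "'i set \<Rightarrow> ('i \<Rightarrow> 'i \<Rightarrow> bool) \<Rightarrow> ('i \<Rightarrow> 'a topology) \<Rightarrow> ('i \<Rightarrow> 'i \<Rightarrow> 'a \<Rightarrow> 'a) \<Rightarrow> bool" where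
  "inverse_system_spaces J leq X p \<longleftrightarrow>
     inverse_system_sets J leq (\<lambda>i. topspace (X i)) p \<and>
     (\<forall>i\<in>J. \<forall>j\<in>J. leq j i \<longrightarrow> continuous_map (X i) (X j) (p i j))"

definition inverse_system_groups ::
    "'i set \<Rightarrow> ('i \<Rightarrow> 'i \<Rightarrow> bool) \<Rightarrow> ('i \<Rightarrow> 'g monoid) \<Rightarrow> ('i \<Rightarrow> 'i \<Rightarrow> 'g \<Rightarrow> 'g) \<Rightarrow> bool" where
  "inverse_system_groups J leq G h \<longleftrightarrow>
     (\<forall>i\<in>J. group (G i)) \<and>
     inverse_system_sets J leq (\<lambda>i. carrier (G i)) h \<and>
     (\<forall>i\<in>J. \<forall>j\<in>J. leq j i \<longrightarrow> h i j \<in> hom (G i) (G j))"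

definition threads ::
    "'i set \<Rightarrow> ('i \<Rightarrow> 'i \<Rightarrow> bool) \<Rightarrow> ('i \<Rightarrow> 'a set) \<Rightarrow> ('i \<Rightarrow> 'i \<Rightarrow> 'a \<Rightarrow> 'a) \<Rightarrow> ('i \<Rightarrow> 'a) set" where
  "threads J leq S p =
     {x \<in> (\<Pi>\<^sub>E i\<in>J. S i). \<forall>i\<in>J. \<forall>j\<in>J. leq j i \<longrightarrow> p i j (x i) = x j}"

definition lim_space ::
    "'i set \<Rightarrow> ('i \<Rightarrow> 'i \<Rightarrow> bool) \<Rightarrow> ('i \<Rightarrow> 'a topology) \<Rightarrow> ('i \<Rightarrow> 'i \<Rightarrow> 'a \<Rightarrow> 'a) \<Rightarrow>
     ('i \<Rightarrow> 'a) topology" where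
  "lim_space J leq X p =
     subtopology (product_topology X J) (threads J leq (\<lambda>i. topspace (X i)) p)"

definition lim_group ::
    "'i set \<Rightarrow> ('i \<Rightarrow> 'i \<Rightarrow> bool) \<Rightarrow> ('i \<Rightarrow> 'g monoid) \<Rightarrow> ('i \<Rightarrow> 'i \<Rightarrow> 'g \<Rightarrow> 'g) \<Rightarrow>
     ('i \<Rightarrow> 'g) monoid" where
  "lim_group J leq G h =
     (product_group J G)\<lparr>carrier := threads J leq (\<lambda>i. carrier (G i)) h\<rparr>"

definition lim_PQ_space ::
    "complex set \<Rightarrow> 'i set \<Rightarrow> ('i \<Rightarrow> 'i \<Rightarrow> bool) \<Rightarrow> ('i \<Rightarrow> 'a topology) \<Rightarrow>
     ('i \<Rightarrow> 'i \<Rightarrow> 'a \<Rightarrow> 'a) \<Rightarrow> ('i \<Rightarrow> 'g monoid) \<Rightarrow> ('i \<Rightarrow> 'g \<Rightarrow> 'a \<Rightarrow> 'a) \<Rightarrow>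
     ('i \<Rightarrow> 'a measure) topology" where
  "lim_PQ_space F J leq X p G a =
     subtopology (product_topology (\<lambda>i. PQ_space F (X i) (G i) (a i)) J)
       {\<mu> \<in> (\<Pi>\<^sub>E i\<in>J. PQplus (X i) (G i) (a i)).
          \<forall>i\<in>J. \<forall>j\<in>J. leq j i \<longrightarrow>
            (\<forall>B\<in>sets (baire (X j)).
               emeasure (\<mu> i) (p i j -` B \<inter> topspace (X i)) = emeasure (\<mu> j) B)}"

end

theory Submission
  imports Defs
begin

text \<open>
  The embedding sends a measure on \<open>X\<close> to the family of its images (marginals) under the projections
  \<open>X \<rightarrow> Xs i\<close>. Projections commute with translation, so integrals of functions of one coordinate
  against a translate of \<open>m\<close> depend only on one marginal, and the map is continuous for the weak
  topologies. The content of the theorem is that the marginals recover \<open>m\<close> and its weak topology,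
  although the Baire sets of the \<open>Xs i\<close> need not generate those of \<open>X\<close>.

  This rests on tightness (\<open>tight\<close>). The marginals are Radon and \<open>J\<close> is countable, so for each \<open>\<epsilon>\<close> there
  are compact sets \<open>K i\<close> whose product, intersected with the threads, is a compact subset of \<open>X\<close> with the
  property that \<open>m\<close> gives measure at most \<open>\<epsilon>\<close> to the complement of every open Baire set containing it.
  Since compact sets need not be measurable, the estimate passes from the marginals to \<open>m\<close> through
  products of open neighbourhoods (\<open>compact_box_neighbourhood\<close>).

  Now let \<open>f\<close> be a bounded continuous real function on \<open>X\<close> and \<open>m\<^sub>0\<close> a finite Baire measure. Complete
  regularity of the \<open>Xs i\<close>, compactness and tightness give a function \<open>u \<le> f\<close> of one coordinate with
  \<open>\<integral>f dm\<^sub>0 < \<integral>u dm\<^sub>0 + \<epsilon>\<close> (\<open>cylinder_lower_approximation\<close>). For every other measure \<open>m\<close> one has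
  \<open>\<integral>f dm \<ge> \<integral>u dm\<close>, and \<open>\<integral>u dm\<close> is a continuous function of the marginals. Hence \<open>\<integral>f dm\<close> is lower
  semicontinuous in the marginals; replacing \<open>f\<close> by \<open>-f\<close> gives continuity. The same inequalities show
  that measures with equal marginals have equal integrals, hence are equal. The action is
  Baire measurable, so the translates \<open>m\<^sup>g\<close> are again finite Baire measures and the argument applies to
  them even when the action is not continuous.
\<close>

section \<open>Baire measures\<close>

lemma zero_sets_subset: "zero_sets Y \<subseteq> Pow (topspace Y)"
  by (auto simp: zero_sets_def)

lemma space_baire [simp]: "space (baire Y) = topspace Y"
  by (simp add: baire_def space_measure_of zero_sets_subset)

lemma sets_baire: "sets (baire Y) = sigma_sets (topspace Y) (zero_sets Y)"
  by (simp add: baire_def sets_measure_of zero_sets_subset)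

lemma Cb_of_real:
  assumes "continuous_map Y euclideanreal f" "bounded (f ` topspace Y)" "F = \<real> \<or> F = UNIV"
  shows "(\<lambda>x. complex_of_real (f x)) \<in> Cb Y F"
proof -
  have "continuous_map Y euclidean (complex_of_real \<circ> f)"
    using assms(1) by (rule continuous_map_compose) (auto simp: continuous_intros)
  moreover have "bounded ((\<lambda>x. complex_of_real (f x)) ` topspace Y)"
    using assms(2) by (simp add: bounded_iff)
  ultimately show ?thesis
    using assms(3) by (auto simp: Cb_def o_def)
qed

lemma zero_set_of_real:
  assumes "continuous_map Y euclideanreal f"
  shows "{x \<in> topspace Y. f x = 0} \<in> zero_sets Y"
proof -
  let ?g = "\<lambda>x. min 1 \<bar>f x\<bar>"
  have "continuous_map Y euclideanreal ?g"
    using assms by (intro continuous_intros) auto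
  moreover have "bounded (?g ` topspace Y)"
    by (auto simp: bounded_iff intro!: exI[of _ 1])
  ultimately have "(\<lambda>x. complex_of_real (?g x)) \<in> Cb Y \<real>"
    by (intro Cb_of_real) auto
  moreover have "{x \<in> topspace Y. f x = 0} = {x \<in> topspace Y. complex_of_real (?g x) = 0}"
    by auto
  ultimately show ?thesis
    unfolding zero_sets_def by (intro image_eqI)
qed

lemma continuous_real_measurable:
  assumes "continuous_map Y euclideanreal f"
  shows "f \<in> borel_measurable (baire Y)"
proof (rule borel_measurable_iff_le[THEN iffD2], intro allI)
  fix a
  have "continuous_map Y euclideanreal (\<lambda>x. max (f x - a) 0)"
    using assms by (intro continuous_intros) auto
  then have "{x \<in> topspace Y. max (f x - a) 0 = 0} \<in> zero_sets Y"
    by (rule zero_set_of_real)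
  moreover have "{x \<in> topspace Y. max (f x - a) 0 = 0} = {w \<in> space (baire Y). f w \<le> a}"
    by auto
  ultimately show "{w \<in> space (baire Y). f w \<le> a} \<in> sets (baire Y)"
    by (auto simp: sets_baire)
qed

lemma Cb_Re_Im:
  assumes "f \<in> Cb Y F"
  shows "continuous_map Y euclideanreal (\<lambda>x. Re (f x))" "bounded ((\<lambda>x. Re (f x)) ` topspace Y)"
    and "continuous_map Y euclideanreal (\<lambda>x. Im (f x))" "bounded ((\<lambda>x. Im (f x)) ` topspace Y)"
proof -
  have f: "continuous_map Y euclidean f" and b: "bounded (f ` topspace Y)"
    using assms by (auto simp: Cb_def)
  have "continuous_map Y euclideanreal (Re \<circ> f)" "continuous_map Y euclideanreal (Im \<circ> f)"
    using f by (rule continuous_map_compose; auto intro!: continuous_intros)+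
  then show "continuous_map Y euclideanreal (\<lambda>x. Re (f x))"
    and "continuous_map Y euclideanreal (\<lambda>x. Im (f x))"
    by (simp_all add: o_def)
  have "bounded (Re ` (f ` topspace Y))" "bounded (Im ` (f ` topspace Y))"
    by (rule bounded_linear_image[OF b bounded_linear_Re],
        rule bounded_linear_image[OF b bounded_linear_Im])
  then show "bounded ((\<lambda>x. Re (f x)) ` topspace Y)" "bounded ((\<lambda>x. Im (f x)) ` topspace Y)"
    by (simp_all add: image_image)
qed

lemma Cb_measurable: "f \<in> Cb Y F \<Longrightarrow> f \<in> borel_measurable (baire Y)"
  by (rule borel_measurable_complex_iff[THEN iffD2]) (auto intro!: continuous_real_measurable Cb_Re_Im)

lemma Cb_compose:
  assumes "continuous_map Y Z q" "f \<in> Cb Z F"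
  shows "(\<lambda>x. f (q x)) \<in> Cb Y F"
proof -
  have "(f \<circ> q) ` topspace Y \<subseteq> f ` topspace Z"
    using assms by (auto simp: continuous_map_def)
  then have "f \<circ> q \<in> Cb Y F"
    using assms(2) continuous_map_compose[OF assms(1)] bounded_subset by (fastforce simp: Cb_def)
  then show ?thesis by (simp add: o_def)
qed

lemma continuous_map_baire_measurable:
  assumes "continuous_map Y Z q"
  shows "q \<in> measurable (baire Y) (baire Z)"
  unfolding baire_def[of Z]
proof (rule measurable_measure_of)
  show "zero_sets Z \<subseteq> Pow (topspace Z)" by (rule zero_sets_subset)
  show "q \<in> space (baire Y) \<rightarrow> topspace Z"
    using assms by (auto simp: continuous_map_def)
  fix A assume "A \<in> zero_sets Z"
  then obtain f where f: "f \<in> Cb Z \<real>" "A = {x \<in> topspace Z. f x = 0}"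
    by (auto simp: zero_sets_def)
  have "(\<lambda>x. f (q x)) \<in> Cb Y \<real>"
    using assms f(1) by (rule Cb_compose)
  moreover have "q -` A \<inter> space (baire Y) = {x \<in> topspace Y. f (q x) = 0}"
    using assms by (auto simp: f(2) continuous_map_def)
  ultimately show "q -` A \<inter> space (baire Y) \<in> sets (baire Y)"
    unfolding sets_baire zero_sets_def by (intro sigma_sets.Basic) (auto intro!: image_eqI)
qed

lemma zero_sets_subset_algebra: "zero_sets Y \<subseteq> zero_set_algebra Y"
  by (auto simp: zero_set_algebra_def)

lemma zero_set_algebra_subset_baire: "zero_set_algebra Y \<subseteq> sets (baire Y)"
proof -
  have "algebra (topspace Y) (sets (baire Y))"
    using sets.algebra_axioms[of "baire Y"] by simp
  moreover have "zero_sets Y \<subseteq> sets (baire Y)"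
    by (auto simp: sets_baire)
  ultimately show ?thesis
    unfolding zero_set_algebra_def by blast
qed

text \<open>An admissible action need not be continuous. It is measurable because the preimage of a zero
  set under \<open>g\<close> is its image under the inverse of \<open>g\<close>.\<close>

lemma admissible_action_measurable:
  assumes "admissible_action H Y a" "g \<in> carrier H"
  shows "a g \<in> measurable (baire Y) (baire Y)"
proof -
  have act: "group_action H (topspace Y) a"
    using assms(1) by (simp add: admissible_action_def)
  then interpret group_action H "topspace Y" a .
  interpret group H using group_hom group_hom.axioms(1) by auto
  have inv: "inv\<^bsub>H\<^esub> g \<in> carrier H"
    using assms(2) by simp
  show ?thesis
    unfolding baire_def[of Y]
  proof (rule measurable_measure_of)
    show "zero_sets Y \<subseteq> Pow (topspace Y)" by (rule zero_sets_subset)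
    show "a g \<in> space (sigma (topspace Y) (zero_sets Y)) \<rightarrow> topspace Y"
      using element_image[OF assms(2)] by (auto simp: space_measure_of zero_sets_subset)
    fix A assume A: "A \<in> zero_sets Y"
    then have sub: "A \<subseteq> topspace Y" using zero_sets_subset by blast
    have "a g -` A \<inter> topspace Y = a (inv\<^bsub>H\<^esub> g) ` A"
    proof (intro equalityI subsetI)
      fix x assume "x \<in> a g -` A \<inter> topspace Y"
      then show "x \<in> a (inv\<^bsub>H\<^esub> g) ` A"
        using orbit_sym_aux[OF assms(2) _ refl, of x] by (metis IntD1 IntD2 imageI vimageD)
    next
      fix y assume "y \<in> a (inv\<^bsub>H\<^esub> g) ` A"
      then obtain x where x: "x \<in> A" "y = a (inv\<^bsub>H\<^esub> g) x" "x \<in> topspace Y"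
        using sub by blast
      then show "y \<in> a g -` A \<inter> topspace Y"
        using orbit_sym_aux[OF inv x(3) refl] element_image[OF inv x(3) refl] assms(2) by simp
    qed
    also have "\<dots> \<in> zero_set_algebra Y"
      using assms(1) inv A zero_sets_subset_algebra unfolding admissible_action_def by blast
    finally show "a g -` A \<inter> space (sigma (topspace Y) (zero_sets Y)) \<in> sets (sigma (topspace Y) (zero_sets Y))"
      using zero_set_algebra_subset_baire[of Y] by (auto simp: space_measure_of zero_sets_subset baire_def)
  qed
qed

lemma bounded_integrable:
  fixes f :: "'a \<Rightarrow> 'b::{banach, second_countable_topology}"
  assumes "finite_measure m" "f \<in> borel_measurable m" "bounded (f ` space m)"
  shows "integrable m f"
proof -
  obtain B where "\<And>x. x \<in> space m \<Longrightarrow> norm (f x) \<le> B"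
    using assms(3) by (auto simp: bounded_iff)
  then show ?thesis
    by (intro finite_measure.integrable_const_bound[OF assms(1) _ assms(2), of B] AE_I2)
qed

lemma continuous_integrable:
  assumes "finite_measure m" "sets m = sets (baire Y)"
    and "continuous_map Y euclideanreal f" "bounded (f ` topspace Y)"
  shows "integrable m f"
proof (rule bounded_integrable[OF assms(1)])
  show "f \<in> borel_measurable m"
    using continuous_real_measurable[OF assms(3)] by (simp add: assms(2) cong: measurable_cong_sets)
  show "bounded (f ` space m)"
    using assms(4) sets_eq_imp_space_eq[OF assms(2)] by simp
qed

lemma Cb_integrable:
  assumes "finite_measure m" "sets m = sets (baire Y)" "f \<in> Cb Y F"
  shows "integrable m f"
proof (rule bounded_integrable[OF assms(1)])
  show "f \<in> borel_measurable m"
    using Cb_measurable[OF assms(3)] by (simp add: assms(2) cong: measurable_cong_sets)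
  show "bounded (f ` space m)"
    using assms(3) sets_eq_imp_space_eq[OF assms(2)] by (simp add: Cb_def)
qed

lemma Int_stable_zero_sets: "Int_stable (zero_sets Y)"
proof (rule Int_stableI)
  fix A B assume "A \<in> zero_sets Y" "B \<in> zero_sets Y"
  then obtain f g where f: "f \<in> Cb Y \<real>" "A = {x \<in> topspace Y. f x = 0}"
    and g: "g \<in> Cb Y \<real>" "B = {x \<in> topspace Y. g x = 0}"
    by (auto simp: zero_sets_def)
  have "continuous_map Y euclideanreal (\<lambda>x. norm (f x) + norm (g x))"
    using f g by (intro continuous_intros) (auto simp: Cb_def)
  then have "{x \<in> topspace Y. norm (f x) + norm (g x) = 0} \<in> zero_sets Y"
    by (rule zero_set_of_real)
  moreover have "{x \<in> topspace Y. norm (f x) + norm (g x) = 0} = A \<inter> B"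
    using f g by (auto simp: add_nonneg_eq_0_iff)
  ultimately show "A \<inter> B \<in> zero_sets Y" by simp
qed

text \<open>The indicator of a zero set of \<open>f\<close> is the decreasing limit of \<open>max 0 (1 - n \<bar>f\<bar>)\<close>.\<close>

lemma baire_measure_eqI:
  assumes m: "finite_measure m" "sets m = sets (baire Y)"
    and m': "finite_measure m'" "sets m' = sets (baire Y)"
    and eq: "\<And>f. continuous_map Y euclideanreal f \<Longrightarrow> bounded (f ` topspace Y) \<Longrightarrow>
      (\<integral>x. f x \<partial>m) = (\<integral>x. f x \<partial>m')"
  shows "m = m'"
proof (rule measure_eqI_generator_eq[OF Int_stable_zero_sets zero_sets_subset, where A = "\<lambda>_. topspace Y"])
  have lim: "(\<lambda>n. \<integral>x. max 0 (1 - real n * norm (f x)) \<partial>\<nu>) \<longlonglongrightarrow> measure \<nu> {x \<in> topspace Y. f x = 0}"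
    if f: "f \<in> Cb Y \<real>" and \<nu>: "finite_measure \<nu>" "sets \<nu> = sets (baire Y)" for f \<nu>
  proof -
    have sp: "space \<nu> = topspace Y"
      using sets_eq_imp_space_eq[OF \<nu>(2)] by simp
    have Z: "{x \<in> topspace Y. f x = 0} \<in> sets \<nu>"
      using f by (auto simp: \<nu>(2) sets_baire zero_sets_def)
    have [measurable]: "f \<in> borel_measurable \<nu>"
      using Cb_measurable[OF f] by (simp add: \<nu>(2) cong: measurable_cong_sets)
    have "(\<lambda>n. \<integral>x. max 0 (1 - real n * norm (f x)) \<partial>\<nu>)
        \<longlonglongrightarrow> (\<integral>x. indicat_real {x \<in> topspace Y. f x = 0} x \<partial>\<nu>)"
    proof (rule integral_dominated_convergence[where w = "\<lambda>_. 1"])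
      show "indicat_real {x \<in> topspace Y. f x = 0} \<in> borel_measurable \<nu>"
        using Z by simp
      show "integrable \<nu> (\<lambda>_. 1::real)"
        using finite_measure.integrable_const[OF \<nu>(1)] .
      show "AE x in \<nu>. (\<lambda>n. max 0 (1 - real n * norm (f x)))
          \<longlonglongrightarrow> indicat_real {x \<in> topspace Y. f x = 0} x"
      proof (rule AE_I2)
        fix x assume x: "x \<in> space \<nu>"
        show "(\<lambda>n. max 0 (1 - real n * norm (f x))) \<longlonglongrightarrow> indicat_real {x \<in> topspace Y. f x = 0} x"
        proof (cases "f x = 0")
          case False
          obtain N where N: "1 / norm (f x) < real N"
            using reals_Archimedean2 by blast
          have "eventually (\<lambda>n. max 0 (1 - real n * norm (f x)) = 0) sequentially"
          proof (rule eventually_sequentiallyI[of N])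
            fix n assume "N \<le> n"
            then have "1 / norm (f x) < real n" using N by linarith
            then show "max 0 (1 - real n * norm (f x)) = 0"
              using False by (simp add: field_simps)
          qed
          then show ?thesis
            using False by (simp add: tendsto_eventually)
        qed (use x sp in simp)
      qed
    qed (auto intro!: AE_I2)
    then show ?thesis
      using Z finite_measure.emeasure_finite[OF \<nu>(1)] by (simp add: less_top sp Int_absorb2)
  qed
  fix A assume "A \<in> zero_sets Y"
  then obtain f where f: "f \<in> Cb Y \<real>" "A = {x \<in> topspace Y. f x = 0}"
    by (auto simp: zero_sets_def)
  have "(\<integral>x. max 0 (1 - real n * norm (f x)) \<partial>m) = (\<integral>x. max 0 (1 - real n * norm (f x)) \<partial>m')" for n
  proof (rule eq)
    show "continuous_map Y euclideanreal (\<lambda>x. max 0 (1 - real n * norm (f x)))"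
      using f by (intro continuous_intros) (auto simp: Cb_def)
    show "bounded ((\<lambda>x. max 0 (1 - real n * norm (f x))) ` topspace Y)"
      by (auto simp: bounded_iff intro!: exI[of _ 1])
  qed
  then have "measure m A = measure m' A"
    using LIMSEQ_unique[OF lim[OF f(1) m]] lim[OF f(1) m'] f(2) by simp
  then show "emeasure m A = emeasure m' A"
    using m(1) m'(1) by (simp add: finite_measure.emeasure_eq_measure)
next
  have "{x \<in> topspace Y. (0::real) = 0} \<in> zero_sets Y"
    by (rule zero_set_of_real) simp
  then show "range (\<lambda>_::nat. topspace Y) \<subseteq> zero_sets Y"
    by auto
  show "emeasure m (topspace Y) \<noteq> \<infinity>"
    using m(1) by (simp add: finite_measure.emeasure_finite)
qed (use m m' in \<open>auto simp: sets_baire\<close>)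

section \<open>Neighbourhoods of products of compact sets\<close>

text \<open>If finitely many boxes cover \<open>\<Pi>\<^sub>E i\<in>I. K i\<close>, call, for fixed \<open>i\<close>, the set of boxes whose \<open>i\<close>-th side contains \<open>x\<close> the
  type of \<open>x\<close>. The points of the \<open>i\<close>-th factor whose type includes that of some point of \<open>K i\<close> form
  an open set, and the product of these sets is covered by the same boxes.\<close>

lemma compact_box_neighbourhood:
  assumes K: "\<And>i. i \<in> I \<Longrightarrow> compactin (X i) (K i)"
    and W: "openin (product_topology X I) W" "PiE I K \<subseteq> W"
  obtains U where "\<And>i. i \<in> I \<Longrightarrow> openin (X i) (U i)" "\<And>i. i \<in> I \<Longrightarrow> K i \<subseteq> U i" "PiE I U \<subseteq> W"
proof -
  define \<C> where "\<C> = {PiE I V | V. finite {i \<in> I. V i \<noteq> topspace (X i)} \<and>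
    (\<forall>i\<in>I. openin (X i) (V i)) \<and> PiE I V \<subseteq> W}"
  have "compactin (product_topology X I) (PiE I K)"
    using K by (simp add: compactin_PiE)
  moreover have "\<forall>C\<in>\<C>. openin (product_topology X I) C"
    by (auto simp: \<C>_def openin_PiE_gen)
  moreover have "PiE I K \<subseteq> \<Union>\<C>"
  proof
    fix x assume "x \<in> PiE I K"
    then have "x \<in> W" using W(2) by blast
    then obtain V where "finite {i \<in> I. V i \<noteq> topspace (X i)}" "\<forall>i\<in>I. openin (X i) (V i)"
        "x \<in> PiE I V" "PiE I V \<subseteq> W"
      using W(1) unfolding openin_product_topology_alt by blast
    then show "x \<in> \<Union>\<C>" unfolding \<C>_def by blast
  qed
  ultimately obtain \<F> where \<F>: "finite \<F>" "\<F> \<subseteq> \<C>" "PiE I K \<subseteq> \<Union>\<F>"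
    unfolding compactin_def by meson
  have "\<forall>C\<in>\<F>. \<exists>V. C = PiE I V \<and> (\<forall>i\<in>I. openin (X i) (V i)) \<and> PiE I V \<subseteq> W"
    using \<F>(2) unfolding \<C>_def by blast
  then obtain V where V: "\<And>C. C \<in> \<F> \<Longrightarrow> C = PiE I (V C)"
      "\<And>C i. C \<in> \<F> \<Longrightarrow> i \<in> I \<Longrightarrow> openin (X i) (V C i)" "\<And>C. C \<in> \<F> \<Longrightarrow> PiE I (V C) \<subseteq> W"
    by metis
  define T where "T i x = {C \<in> \<F>. x \<in> V C i}" for i x
  define U where "U i = (\<Union>x\<in>K i. (\<Inter>C\<in>T i x. V C i) \<inter> topspace (X i))" for i
  show thesis
  proof
    fix i assume i: "i \<in> I"
    have "openin (X i) ((\<Inter>C\<in>T i x. V C i) \<inter> topspace (X i))" for x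
      using \<F>(1) V(2) i by (intro openin_INT) (auto simp: T_def)
    then show "openin (X i) (U i)"
      unfolding U_def by blast
    have "K i \<subseteq> topspace (X i)"
      using K[OF i] by (rule compactin_subset_topspace)
    then show "K i \<subseteq> U i"
      by (auto simp: U_def T_def)
  next
    show "PiE I U \<subseteq> W"
    proof
      fix y assume y: "y \<in> PiE I U"
      then have "\<forall>i\<in>I. \<exists>x\<in>K i. y i \<in> (\<Inter>C\<in>T i x. V C i)"
        by (auto simp: PiE_iff U_def)
      then obtain x where x: "\<And>i. i \<in> I \<Longrightarrow> x i \<in> K i" "\<And>i. i \<in> I \<Longrightarrow> y i \<in> (\<Inter>C\<in>T i (x i). V C i)"
        by metis
      have "restrict x I \<in> PiE I K"
        using x(1) by simp
      then obtain C where C: "C \<in> \<F>" "restrict x I \<in> C"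
        using \<F>(3) by blast
      then have "restrict x I \<in> PiE I (V C)"
        using V(1)[OF C(1)] by blast
      then have "C \<in> T i (x i)" if "i \<in> I" for i
        using C(1) that by (auto simp: T_def PiE_iff)
      then have "y i \<in> V C i" if "i \<in> I" for i
        using x(2)[OF that] that by blast
      then have "y \<in> PiE I (V C)"
        using y by (auto simp: PiE_iff)
      then show "y \<in> W" using V(3)[OF C(1)] by blast
    qed
  qed
qed

section \<open>The weak topology as an initial topology\<close>

lemma continuous_map_tau_w_integral:
  assumes "f \<in> Cb Y F" "g \<in> carrier H"
  shows "continuous_map (tau_w F Y H a) euclidean (\<lambda>m. \<integral>x. f x \<partial>translate a g m)"
  unfolding continuous_map_def
proof (intro conjI allI impI)
  fix T :: "complex set" assume "openin euclidean T"
  then have T: "open T" by simp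
  let ?I = "\<lambda>m. \<integral>x. f x \<partial>translate a g m"
  show "openin (tau_w F Y H a) {m \<in> topspace (tau_w F Y H a). ?I m \<in> T}"
    unfolding openin_tau_w topspace_tau_w
  proof (rule weak_openI)
    fix m0 assume "m0 \<in> {m \<in> Qplus Y H a. ?I m \<in> T}"
    then obtain e where e: "0 < e" "\<And>z. dist z (?I m0) < e \<Longrightarrow> z \<in> T"
      using T by (auto simp: open_dist)
    have "weak_nbhd Y H a m0 {f} {g} e \<subseteq> {m \<in> Qplus Y H a. ?I m \<in> T}"
      using e(2) by (auto simp: weak_nbhd_def dist_norm)
    then show "\<exists>\<Phi> L y. finite \<Phi> \<and> \<Phi> \<subseteq> Cb Y F \<and> finite L \<and> L \<subseteq> carrier H \<and> 0 < y \<and>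
        weak_nbhd Y H a m0 \<Phi> L y \<subseteq> {m \<in> Qplus Y H a. ?I m \<in> T}"
      using e(1) assms by (intro exI[of _ "{f}"] exI[of _ "{g}"] exI[of _ e]) simp
  qed auto
qed simp

lemma continuous_map_into_tau_w:
  assumes k: "\<And>z. z \<in> topspace Z \<Longrightarrow> k z \<in> Qplus Y H a"
    and cont: "\<And>f g. f \<in> Cb Y F \<Longrightarrow> g \<in> carrier H \<Longrightarrow>
      continuous_map Z euclidean (\<lambda>z. \<integral>x. f x \<partial>translate a g (k z))"
  shows "continuous_map Z (tau_w F Y H a) k"
  unfolding continuous_map_def
proof (intro conjI allI impI)
  show "k \<in> topspace Z \<rightarrow> topspace (tau_w F Y H a)"
    using k by (simp add: topspace_tau_w)
  fix U assume "openin (tau_w F Y H a) U"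
  then have U: "weak_open F Y H a U" by (simp add: openin_tau_w)
  show "openin Z {z \<in> topspace Z. k z \<in> U}"
  proof (subst openin_subopen, intro ballI)
    fix z0 assume z0: "z0 \<in> {z \<in> topspace Z. k z \<in> U}"
    then have "k z0 \<in> U" by simp
    then obtain \<Phi> L y where N: "finite \<Phi>" "\<Phi> \<subseteq> Cb Y F" "finite L" "L \<subseteq> carrier H" "0 < y"
        "weak_nbhd Y H a (k z0) \<Phi> L y \<subseteq> U"
      using weak_openD[OF U] by metis
    let ?I = "\<lambda>f g z. \<integral>x. f x \<partial>translate a g (k z)"
    let ?N = "\<lambda>(f, g). {z \<in> topspace Z. ?I f g z \<in> ball (?I f g z0) y}"
    have "openin Z (?N q)" if qN: "q \<in> \<Phi> \<times> L" for q
    proof -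
      obtain f g where q: "q = (f, g)" "f \<in> \<Phi>" "g \<in> L"
        using qN by blast
      have "continuous_map Z euclidean (?I f g)"
        using q(2,3) N(2,4) by (intro cont) auto
      then show ?thesis
        unfolding q(1) prod.case by (rule openin_continuous_map_preimage) simp
    qed
    then have "openin Z ((\<Inter>q\<in>\<Phi> \<times> L. ?N q) \<inter> topspace Z)"
      using N(1,3) by (intro openin_INT) auto
    moreover have "z0 \<in> (\<Inter>q\<in>\<Phi> \<times> L. ?N q) \<inter> topspace Z"
      using z0 N(5) by auto
    moreover have "(\<Inter>q\<in>\<Phi> \<times> L. ?N q) \<inter> topspace Z \<subseteq> {z \<in> topspace Z. k z \<in> U}"
    proof
      fix z assume z: "z \<in> (\<Inter>q\<in>\<Phi> \<times> L. ?N q) \<inter> topspace Z"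
      then have "k z \<in> weak_nbhd Y H a (k z0) \<Phi> L y"
        using k by (fastforce simp: weak_nbhd_def dist_norm norm_minus_commute)
      then show "z \<in> {z \<in> topspace Z. k z \<in> U}"
        using z N(6) by blast
    qed
    ultimately show "\<exists>T. openin Z T \<and> z0 \<in> T \<and> T \<subseteq> {z \<in> topspace Z. k z \<in> U}"
      by blast
  qed
qed

lemma continuous_map_real_sandwich:
  fixes r :: "'z \<Rightarrow> real"
  assumes below: "\<And>z e. z \<in> topspace Z \<Longrightarrow> 0 < e \<Longrightarrow> \<exists>c. continuous_map Z euclideanreal c \<and>
      (\<forall>w\<in>topspace Z. c w \<le> r w) \<and> r z < c z + e"
    and above: "\<And>z e. z \<in> topspace Z \<Longrightarrow> 0 < e \<Longrightarrow> \<exists>c. continuous_map Z euclideanreal c \<and>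
      (\<forall>w\<in>topspace Z. r w \<le> c w) \<and> c z < r z + e"
  shows "continuous_map Z euclideanreal r"
  unfolding continuous_map_upper_lower_semicontinuous_lt
proof (intro conjI allI; subst openin_subopen; intro ballI)
  fix a z assume z: "z \<in> {x \<in> topspace Z. a < r x}"
  then obtain c where c: "continuous_map Z euclideanreal c" "\<forall>w\<in>topspace Z. c w \<le> r w"
      "r z < c z + (r z - a)"
    using below[of z "r z - a"] by auto
  have "openin Z {x \<in> topspace Z. a < c x}"
    using c(1) unfolding continuous_map_upper_lower_semicontinuous_lt by blast
  moreover have "{x \<in> topspace Z. a < c x} \<subseteq> {x \<in> topspace Z. a < r x}"
    using c(2) by force
  ultimately show "\<exists>T. openin Z T \<and> z \<in> T \<and> T \<subseteq> {x \<in> topspace Z. a < r x}"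
    using z c(3) by (intro exI[of _ "{x \<in> topspace Z. a < c x}"]) auto
next
  fix a z assume z: "z \<in> {x \<in> topspace Z. r x < a}"
  then obtain c where c: "continuous_map Z euclideanreal c" "\<forall>w\<in>topspace Z. r w \<le> c w"
      "c z < r z + (a - r z)"
    using above[of z "a - r z"] by auto
  have "openin Z {x \<in> topspace Z. c x < a}"
    using c(1) unfolding continuous_map_upper_lower_semicontinuous_lt by blast
  moreover have "{x \<in> topspace Z. c x < a} \<subseteq> {x \<in> topspace Z. r x < a}"
    using c(2) by force
  ultimately show "\<exists>T. openin Z T \<and> z \<in> T \<and> T \<subseteq> {x \<in> topspace Z. r x < a}"
    using z c(3) by (intro exI[of _ "{x \<in> topspace Z. c x < a}"]) auto
qed

section \<open>Limits of inverse systems of spaces\<close>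

text \<open>A space \<open>X\<close> identified by \<open>\<phi>\<close> with the space of threads of a directed system of Tychonoff spaces;
  the \<open>i\<close>-th projection is \<open>\<lambda>x. \<phi> x i\<close>.\<close>

locale inverse_limit_space =
  fixes J :: "'i set" and leq :: "'i \<Rightarrow> 'i \<Rightarrow> bool"
    and Xs :: "'i \<Rightarrow> 'a topology" and p :: "'i \<Rightarrow> 'i \<Rightarrow> 'a \<Rightarrow> 'a"
    and X :: "'x topology" and \<phi> :: "'x \<Rightarrow> 'i \<Rightarrow> 'a"
  assumes directed: "directed_set J leq"
    and spaces: "inverse_system_spaces J leq Xs p"
    and Tychonoff: "\<And>i. i \<in> J \<Longrightarrow> Tychonoff_space (Xs i)"
    and limit: "homeomorphic_map X (lim_space J leq Xs p) \<phi>"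
begin

lemma \<phi>_image: "\<phi> ` topspace X = threads J leq (\<lambda>i. topspace (Xs i)) p"
proof -
  have "threads J leq (\<lambda>i. topspace (Xs i)) p \<subseteq> topspace (product_topology Xs J)"
    by (auto simp: threads_def)
  then have "topspace (lim_space J leq Xs p) = threads J leq (\<lambda>i. topspace (Xs i)) p"
    by (simp add: lim_space_def Int_absorb1)
  then show ?thesis
    using limit by (simp add: homeomorphic_eq_everything_map)
qed

lemma \<phi>_thread: "x \<in> topspace X \<Longrightarrow> \<phi> x \<in> threads J leq (\<lambda>i. topspace (Xs i)) p"
  using \<phi>_image by blast

lemma inj_\<phi>: "inj_on \<phi> (topspace X)"
  using limit by (simp add: homeomorphic_eq_everything_map)

lemma projection_continuous:
  assumes "i \<in> J"
  shows "continuous_map X (Xs i) (\<lambda>x. \<phi> x i)"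
proof -
  have "continuous_map X (product_topology Xs J) \<phi>"
    using limit by (simp add: homeomorphic_eq_everything_map lim_space_def continuous_map_in_subtopology)
  then show ?thesis
    using assms by (simp add: continuous_map_componentwise)
qed

lemma projection_in: "i \<in> J \<Longrightarrow> x \<in> topspace X \<Longrightarrow> \<phi> x i \<in> topspace (Xs i)"
  using projection_continuous by (auto simp: continuous_map_def)

lemma bonding_projection:
  "\<lbrakk>i \<in> J; j \<in> J; leq j i; x \<in> topspace X\<rbrakk> \<Longrightarrow> p i j (\<phi> x i) = \<phi> x j"
  using \<phi>_thread by (auto simp: threads_def)

lemma bonding_continuous: "\<lbrakk>i \<in> J; j \<in> J; leq j i\<rbrakk> \<Longrightarrow> continuous_map (Xs i) (Xs j) (p i j)"
  using spaces by (auto simp: inverse_system_spaces_def)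

lemma closedin_threads:
  "closedin (product_topology Xs J) (threads J leq (\<lambda>i. topspace (Xs i)) p)"
proof -
  let ?P = "product_topology Xs J"
  let ?E = "\<lambda>(i, j). if i \<in> J \<and> j \<in> J \<and> leq j i then {x \<in> topspace ?P. p i j (x i) = x j} else topspace ?P"
  have "closedin ?P (?E q)" for q
  proof (cases q)
    case (Pair i j)
    show ?thesis
    proof (cases "i \<in> J \<and> j \<in> J \<and> leq j i")
      case True
      have "continuous_map ?P (Xs j) (p i j \<circ> (\<lambda>x. x i))"
        using True by (intro continuous_map_compose[OF continuous_map_product_projection] bonding_continuous) auto
      moreover have "continuous_map ?P (Xs j) (\<lambda>x. x j)"
        using True by (intro continuous_map_product_projection) auto
      moreover have "Hausdorff_space (Xs j)"
        using Tychonoff True by (auto simp: Tychonoff_space_def)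
      ultimately have "closedin ?P {x \<in> topspace ?P. (p i j \<circ> (\<lambda>x. x i)) x = x j}"
        by (intro closedin_continuous_maps_eq)
      then show ?thesis using True by (simp add: Pair)
    next
      case False
      then have "?E q = topspace ?P" by (auto simp: Pair)
      then show ?thesis by (simp only: closedin_topspace)
    qed
  qed
  then have "closedin ?P (\<Inter>q\<in>UNIV. ?E q)"
    by (intro closedin_Inter) auto
  moreover have "(\<Inter>q\<in>UNIV. ?E q) = threads J leq (\<lambda>i. topspace (Xs i)) p"
  proof (intro equalityI subsetI)
    fix x assume x: "x \<in> (\<Inter>q\<in>UNIV. ?E q)"
    then have q: "x \<in> ?E (i, j)" for i j
      by blast
    have "x \<in> topspace ?P"
      using q[of undefined undefined] by (simp split: if_splits)
    moreover have "p i j (x i) = x j" if "i \<in> J" "j \<in> J" "leq j i" for i j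
      using q[of i j] that by simp
    ultimately show "x \<in> threads J leq (\<lambda>i. topspace (Xs i)) p"
      by (simp add: threads_def)
  qed (auto simp: threads_def)
  ultimately show ?thesis by simp
qed

subsection \<open>Cylinder functions\<close>

text \<open>The bounded continuous real functions on the limit that factor through one of the
  projections.\<close>

definition cylinder :: "('x \<Rightarrow> real) \<Rightarrow> bool" where
  "cylinder u \<longleftrightarrow> (\<exists>i\<in>J. \<exists>g. continuous_map (Xs i) euclideanreal g \<and> bounded (g ` topspace (Xs i)) \<and>
     (\<forall>x\<in>topspace X. u x = g (\<phi> x i)))"

lemma cylinderI:
  assumes "i \<in> J" "continuous_map (Xs i) euclideanreal g" "bounded (g ` topspace (Xs i))"
    and "\<And>x. x \<in> topspace X \<Longrightarrow> u x = g (\<phi> x i)"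
  shows "cylinder u"
  using assms unfolding cylinder_def by blast

lemma cylinderE:
  assumes "cylinder u"
  obtains i g where "i \<in> J" "continuous_map (Xs i) euclideanreal g" "bounded (g ` topspace (Xs i))"
    "\<And>x. x \<in> topspace X \<Longrightarrow> u x = g (\<phi> x i)"
  using assms unfolding cylinder_def by blast

lemma cylinder_common_index:
  assumes "cylinder u" "cylinder v"
  obtains k g h where "k \<in> J"
    "continuous_map (Xs k) euclideanreal g" "bounded (g ` topspace (Xs k))"
    "continuous_map (Xs k) euclideanreal h" "bounded (h ` topspace (Xs k))"
    "\<And>x. x \<in> topspace X \<Longrightarrow> u x = g (\<phi> x k)" "\<And>x. x \<in> topspace X \<Longrightarrow> v x = h (\<phi> x k)"
proof -
  obtain i g where u: "i \<in> J" "continuous_map (Xs i) euclideanreal g" "bounded (g ` topspace (Xs i))"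
      "\<And>x. x \<in> topspace X \<Longrightarrow> u x = g (\<phi> x i)"
    using cylinderE[OF assms(1)] by blast
  obtain j h where v: "j \<in> J" "continuous_map (Xs j) euclideanreal h" "bounded (h ` topspace (Xs j))"
      "\<And>x. x \<in> topspace X \<Longrightarrow> v x = h (\<phi> x j)"
    using cylinderE[OF assms(2)] by blast
  obtain k where k: "k \<in> J" "leq i k" "leq j k"
    using directed u(1) v(1) unfolding directed_set_def by blast
  have pi: "continuous_map (Xs k) (Xs i) (p k i)" and pj: "continuous_map (Xs k) (Xs j) (p k j)"
    using bonding_continuous k u(1) v(1) by auto
  show thesis
  proof
    show "continuous_map (Xs k) euclideanreal (g \<circ> p k i)" "continuous_map (Xs k) euclideanreal (h \<circ> p k j)"
      using continuous_map_compose[OF pi u(2)] continuous_map_compose[OF pj v(2)] by auto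
    show "bounded ((g \<circ> p k i) ` topspace (Xs k))"
      using pi by (intro bounded_subset[OF u(3)]) (auto simp: continuous_map_def)
    show "bounded ((h \<circ> p k j) ` topspace (Xs k))"
      using pj by (intro bounded_subset[OF v(3)]) (auto simp: continuous_map_def)
    fix x assume x: "x \<in> topspace X"
    show "u x = (g \<circ> p k i) (\<phi> x k)" "v x = (h \<circ> p k j) (\<phi> x k)"
      using u v k x by (simp_all add: bonding_projection)
  qed (rule k(1))
qed

lemma cylinder_max:
  assumes "cylinder u" "cylinder v"
  shows "cylinder (\<lambda>x. max (u x) (v x))"
proof -
  obtain k g h where k: "k \<in> J"
    "continuous_map (Xs k) euclideanreal g" "bounded (g ` topspace (Xs k))"
    "continuous_map (Xs k) euclideanreal h" "bounded (h ` topspace (Xs k))"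
    "\<And>x. x \<in> topspace X \<Longrightarrow> u x = g (\<phi> x k)" "\<And>x. x \<in> topspace X \<Longrightarrow> v x = h (\<phi> x k)"
    using cylinder_common_index[OF assms] by blast
  show ?thesis
  proof (rule cylinderI[OF k(1)])
    show "continuous_map (Xs k) euclideanreal (\<lambda>z. max (g z) (h z))"
      using k by (intro continuous_intros) auto
    show "bounded ((\<lambda>z. max (g z) (h z)) ` topspace (Xs k))"
      by (rule bounded_subset[OF bounded_Un[THEN iffD2, OF conjI[OF k(3) k(5)]]]) (auto simp: max_def)
  qed (use k in auto)
qed

lemma cylinder_min:
  assumes "cylinder u" "cylinder v"
  shows "cylinder (\<lambda>x. min (u x) (v x))"
proof -
  obtain k g h where k: "k \<in> J"
    "continuous_map (Xs k) euclideanreal g" "bounded (g ` topspace (Xs k))"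
    "continuous_map (Xs k) euclideanreal h" "bounded (h ` topspace (Xs k))"
    "\<And>x. x \<in> topspace X \<Longrightarrow> u x = g (\<phi> x k)" "\<And>x. x \<in> topspace X \<Longrightarrow> v x = h (\<phi> x k)"
    using cylinder_common_index[OF assms] by blast
  show ?thesis
  proof (rule cylinderI[OF k(1)])
    show "continuous_map (Xs k) euclideanreal (\<lambda>z. min (g z) (h z))"
      using k by (intro continuous_intros) auto
    show "bounded ((\<lambda>z. min (g z) (h z)) ` topspace (Xs k))"
      by (rule bounded_subset[OF bounded_Un[THEN iffD2, OF conjI[OF k(3) k(5)]]]) (auto simp: min_def)
  qed (use k in auto)
qed

lemma cylinder_const: "J \<noteq> {} \<Longrightarrow> cylinder (\<lambda>_. c)"
  by (auto simp: cylinder_def bounded_iff intro!: exI[of _ "\<lambda>_. c"])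

lemma cylinder_affine:
  assumes "cylinder u"
  shows "cylinder (\<lambda>x. c * u x + d)"
proof -
  obtain i g where u: "i \<in> J" "continuous_map (Xs i) euclideanreal g" "bounded (g ` topspace (Xs i))"
      "\<And>x. x \<in> topspace X \<Longrightarrow> u x = g (\<phi> x i)"
    using cylinderE[OF assms] by blast
  obtain B where B: "\<And>z. z \<in> topspace (Xs i) \<Longrightarrow> \<bar>g z\<bar> \<le> B"
    using u(3) by (auto simp: bounded_iff)
  have "\<bar>c * g z + d\<bar> \<le> \<bar>c\<bar> * B + \<bar>d\<bar>" if "z \<in> topspace (Xs i)" for z
  proof -
    have "\<bar>c * g z + d\<bar> \<le> \<bar>c\<bar> * \<bar>g z\<bar> + \<bar>d\<bar>"
      by (metis abs_mult abs_triangle_ineq)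
    also have "\<dots> \<le> \<bar>c\<bar> * B + \<bar>d\<bar>"
      using B[OF that] by (simp add: mult_left_mono)
    finally show ?thesis .
  qed
  then have "bounded ((\<lambda>z. c * g z + d) ` topspace (Xs i))"
    by (auto simp: bounded_iff)
  moreover have "continuous_map (Xs i) euclideanreal (\<lambda>z. c * g z + d)"
    using u(2) by (intro continuous_intros) auto
  ultimately show ?thesis
    using u by (intro cylinderI[of i "\<lambda>z. c * g z + d"]) auto
qed

lemma cylinder_continuous:
  assumes "cylinder u"
  shows "continuous_map X euclideanreal u" "bounded (u ` topspace X)"
proof -
  obtain i g where u: "i \<in> J" "continuous_map (Xs i) euclideanreal g" "bounded (g ` topspace (Xs i))"
      "\<And>x. x \<in> topspace X \<Longrightarrow> u x = g (\<phi> x i)"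
    using cylinderE[OF assms] by blast
  have "continuous_map X euclideanreal (g \<circ> (\<lambda>x. \<phi> x i))"
    using continuous_map_compose[OF projection_continuous u(2)] u(1) .
  then show "continuous_map X euclideanreal u"
    by (rule continuous_map_eq) (simp add: u(4))
  show "bounded (u ` topspace X)"
    using u projection_in by (intro bounded_subset[OF u(3)]) auto
qed

lemma cylinder_separates:
  assumes "J \<noteq> {}" "openin X U" "x \<in> U"
  obtains u where "cylinder u" "\<And>y. y \<in> topspace X \<Longrightarrow> 0 \<le> u y" "\<And>y. y \<in> topspace X \<Longrightarrow> u y \<le> 1"
    "u x = 1" "\<And>y. y \<in> topspace X - U \<Longrightarrow> u y = 0"
proof -
  have xX: "x \<in> topspace X"
    using assms(2,3) openin_subset by blast
  have "openin (lim_space J leq Xs p) (\<phi> ` U)"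
    using limit assms(2) by (simp add: homeomorphic_eq_everything_map open_map_def)
  then obtain T where T: "openin (product_topology Xs J) T"
      "\<phi> ` U = T \<inter> threads J leq (\<lambda>i. topspace (Xs i)) p"
    unfolding lim_space_def openin_subtopology by blast
  have "\<phi> x \<in> T" using T(2) assms(3) by blast
  then obtain V where V: "finite {i \<in> J. V i \<noteq> topspace (Xs i)}" "\<forall>i\<in>J. openin (Xs i) (V i)"
      "\<phi> x \<in> PiE J V" "PiE J V \<subseteq> T"
    using T(1) unfolding openin_product_topology_alt by blast
  have "\<exists>u. cylinder u \<and> (\<forall>y\<in>topspace X. 0 \<le> u y \<and> u y \<le> 1) \<and> u x = 1 \<and>
      (\<forall>y\<in>topspace X. (\<exists>i\<in>F. \<phi> y i \<notin> V i) \<longrightarrow> u y = 0)" if "finite F" "F \<subseteq> J" for F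
    using that
  proof (induction F)
    case empty
    show ?case
      using cylinder_const[OF assms(1), of 1] by (intro exI[of _ "\<lambda>_. 1"]) auto
  next
    case (insert i F)
    then obtain u where u: "cylinder u" "\<forall>y\<in>topspace X. 0 \<le> u y \<and> u y \<le> 1" "u x = 1"
        "\<forall>y\<in>topspace X. (\<exists>i\<in>F. \<phi> y i \<notin> V i) \<longrightarrow> u y = 0"
      by blast
    have i: "i \<in> J" using insert.prems by simp
    have "completely_regular_space (Xs i)"
      using Tychonoff[OF i] by (simp add: Tychonoff_space_def)
    moreover have "openin (Xs i) (V i)" "\<phi> x i \<in> V i"
      using V(2,3) i by auto
    ultimately have "\<exists>h. continuous_map (Xs i) euclideanreal h \<and> h (\<phi> x i) = 1 \<and>
        h ` (topspace (Xs i) - V i) \<subseteq> {0}"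
      by (subst (asm) completely_regular_space_gen_alt'[of "1::real" 0 "Xs i"]) auto
    then obtain h where h: "continuous_map (Xs i) euclideanreal h" "h (\<phi> x i) = 1"
        "h ` (topspace (Xs i) - V i) \<subseteq> {0}"
      by blast
    let ?h = "\<lambda>z. max 0 (min 1 (h z))"
    define v where "v y = ?h (\<phi> y i)" for y
    have "cylinder v"
    proof (rule cylinderI[OF i])
      show "continuous_map (Xs i) euclideanreal ?h"
        using h(1) by (intro continuous_intros) auto
      show "bounded (?h ` topspace (Xs i))"
        by (auto simp: bounded_iff intro!: exI[of _ 1])
    qed (simp add: v_def)
    then have "cylinder (\<lambda>y. min (u y) (v y))"
      by (rule cylinder_min[OF u(1)])
    moreover have "v y = 0" if "y \<in> topspace X" "\<phi> y i \<notin> V i" for y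
      using h(3) projection_in[OF i that(1)] that(2) by (auto simp: v_def)
    moreover have "v x = 1" "\<And>y. 0 \<le> v y"
      using h(2) by (simp_all add: v_def)
    ultimately show ?case
      using u(2-4) by (intro exI[of _ "\<lambda>y. min (u y) (v y)"]) (auto simp: min_def)
  qed
  from this[OF V(1)] obtain u where u: "cylinder u" "\<forall>y\<in>topspace X. 0 \<le> u y \<and> u y \<le> 1" "u x = 1"
      "\<forall>y\<in>topspace X. (\<exists>i\<in>{i \<in> J. V i \<noteq> topspace (Xs i)}. \<phi> y i \<notin> V i) \<longrightarrow> u y = 0"
    by auto
  show thesis
  proof (rule that[OF u(1) _ _ u(3)])
    fix y assume y: "y \<in> topspace X - U"
    have "\<phi> y \<notin> \<phi> ` U"
      using y inj_\<phi> openin_subset[OF assms(2)] by (auto simp: inj_on_def)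
    then have "\<phi> y \<notin> PiE J V"
      using T(2) V(4) \<phi>_thread y by blast
    moreover have "\<phi> y \<in> (\<Pi>\<^sub>E i\<in>J. topspace (Xs i))"
      using \<phi>_thread y by (auto simp: threads_def)
    ultimately obtain i where "i \<in> J" "\<phi> y i \<notin> V i" "\<phi> y i \<in> topspace (Xs i)"
      by (auto simp: PiE_iff)
    then show "u y = 0"
      using u(4) y by blast
  qed (use u(2) in auto)
qed

text \<open>One function below \<open>f\<close> everywhere, and uniformly close to \<open>f\<close> on a compact set: the maximum of
  finitely many cylinder functions below \<open>f\<close>, each close to \<open>f\<close> near one point.\<close>

lemma cylinder_approximation:
  assumes "J \<noteq> {}" and f: "continuous_map X euclideanreal f" "\<And>x. x \<in> topspace X \<Longrightarrow> 0 \<le> f x"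
    and K: "compactin X K" and e: "0 < e"
  obtains u where "cylinder u" "\<And>x. x \<in> topspace X \<Longrightarrow> 0 \<le> u x" "\<And>x. x \<in> topspace X \<Longrightarrow> u x \<le> f x"
    "\<And>x. x \<in> K \<Longrightarrow> f x < u x + e"
proof -
  have KX: "K \<subseteq> topspace X"
    using K by (rule compactin_subset_topspace)
  have "\<exists>u. cylinder u \<and> (\<forall>y\<in>topspace X. 0 \<le> u y \<and> u y \<le> f y) \<and> f x < u x + e" if x: "x \<in> K" for x
  proof -
    define c where "c = max 0 (f x - e / 2)"
    let ?U = "{y \<in> topspace X. f x - e / 2 < f y}"
    have "openin X ?U"
      using f(1) unfolding continuous_map_upper_lower_semicontinuous_lt by blast
    moreover have "x \<in> ?U" using x KX e by auto
    ultimately obtain u where u: "cylinder u" "\<And>y. y \<in> topspace X \<Longrightarrow> 0 \<le> u y"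
        "\<And>y. y \<in> topspace X \<Longrightarrow> u y \<le> 1" "u x = 1" "\<And>y. y \<in> topspace X - ?U \<Longrightarrow> u y = 0"
      using cylinder_separates[OF assms(1)] by blast
    have "c * u y + 0 \<le> f y" if y: "y \<in> topspace X" for y
    proof (cases "y \<in> ?U")
      case True
      have "c * u y \<le> c * 1"
        using u(3)[OF y] by (intro mult_left_mono) (auto simp: c_def)
      also have "\<dots> \<le> f y"
        using True f(2)[OF y] by (auto simp: c_def)
      finally show ?thesis by simp
    next
      case False
      then show ?thesis using u(5)[of y] f(2)[OF y] y by simp
    qed
    moreover have "0 \<le> c * u y + 0" if "y \<in> topspace X" for y
      using u(2)[OF that] by (simp add: c_def)
    moreover have "f x < c * u x + 0 + e"
      using e u(4) by (simp add: c_def)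
    ultimately show ?thesis
      using cylinder_affine[OF u(1), of c 0] by blast
  qed
  then obtain u where u: "\<And>x. x \<in> K \<Longrightarrow> cylinder (u x)"
      "\<And>x y. x \<in> K \<Longrightarrow> y \<in> topspace X \<Longrightarrow> 0 \<le> u x y" "\<And>x y. x \<in> K \<Longrightarrow> y \<in> topspace X \<Longrightarrow> u x y \<le> f y"
      "\<And>x. x \<in> K \<Longrightarrow> f x < u x x + e"
    by metis
  define N where "N x = {y \<in> topspace X. f y - u x y < e}" for x
  have "openin X (N x)" if "x \<in> K" for x
  proof -
    have "continuous_map X euclideanreal (\<lambda>y. f y - u x y)"
      using f(1) cylinder_continuous(1)[OF u(1)[OF that]] by (intro continuous_intros) auto
    then show ?thesis
      unfolding N_def continuous_map_upper_lower_semicontinuous_lt by blast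
  qed
  moreover have "K \<subseteq> \<Union>(N ` K)"
    using u(4) KX by (fastforce simp: N_def)
  ultimately obtain \<F> where \<F>: "finite \<F>" "\<F> \<subseteq> N ` K" "K \<subseteq> \<Union>\<F>"
    using compactinD[OF K, of "N ` K"] by blast
  obtain D where D: "D \<subseteq> K" "finite D" "\<F> = N ` D"
    using finite_subset_image[OF \<F>(1,2)] by metis
  have "\<exists>v. cylinder v \<and> (\<forall>y\<in>topspace X. 0 \<le> v y \<and> v y \<le> f y \<and> (\<forall>x\<in>D. u x y \<le> v y))"
    using D(2,1)
  proof (induction D)
    case empty
    show ?case
      using cylinder_const[OF assms(1), of 0] f(2) by (intro exI[of _ "\<lambda>_. 0"]) auto
  next
    case (insert x D)
    then obtain v where v: "cylinder v" "\<forall>y\<in>topspace X. 0 \<le> v y \<and> v y \<le> f y \<and> (\<forall>x\<in>D. u x y \<le> v y)"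
      by blast
    have x: "x \<in> K" using insert.prems by simp
    show ?case
      using cylinder_max[OF u(1)[OF x] v(1)] v(2) u(2,3)[OF x]
      by (intro exI[of _ "\<lambda>y. max (u x y) (v y)"]) (auto simp: le_max_iff_disj)
  qed
  then obtain v where v: "cylinder v" "\<forall>y\<in>topspace X. 0 \<le> v y \<and> v y \<le> f y \<and> (\<forall>x\<in>D. u x y \<le> v y)"
    by blast
  show thesis
  proof (rule that[OF v(1)])
    fix x assume x: "x \<in> K"
    then obtain d where d: "d \<in> D" "x \<in> N d"
      using \<F>(3) D(3) by blast
    then have "u d x \<le> v x" using v(2) KX x by blast
    then show "f x < v x + e"
      using d(2) by (simp add: N_def)
  qed (use v(2) in auto)
qed

end

section \<open>Baire measures on limits of countable systems of Radon spaces\<close>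

context inverse_limit_space
begin

text \<open>The image of a measure under the \<open>i\<close>-th projection, as a measure on the Baire sets.\<close>

definition marginal :: "'x measure \<Rightarrow> 'i \<Rightarrow> 'a measure" where
  "marginal m i = distr m (baire (Xs i)) (\<lambda>x. \<phi> x i)"

lemma sets_marginal [simp]: "sets (marginal m i) = sets (baire (Xs i))"
  by (simp add: marginal_def)

lemma projection_measurable:
  assumes "sets m = sets (baire X)" "i \<in> J"
  shows "(\<lambda>x. \<phi> x i) \<in> measurable m (baire (Xs i))"
  using continuous_map_baire_measurable[OF projection_continuous[OF assms(2)]] assms(1)
  by (simp cong: measurable_cong_sets)

lemma finite_measure_marginal:
  assumes "finite_measure m" "sets m = sets (baire X)" "i \<in> J"
  shows "finite_measure (marginal m i)"
  unfolding marginal_def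
  using finite_measure.finite_measure_distr[OF assms(1) projection_measurable[OF assms(2,3)]] .

lemma emeasure_marginal:
  assumes "sets m = sets (baire X)" "i \<in> J" "B \<in> sets (baire (Xs i))"
  shows "emeasure (marginal m i) B = emeasure m {x \<in> topspace X. \<phi> x i \<in> B}"
proof -
  have "(\<lambda>x. \<phi> x i) -` B \<inter> space m = {x \<in> topspace X. \<phi> x i \<in> B}"
    using sets_eq_imp_space_eq[OF assms(1)] by auto
  then show ?thesis
    unfolding marginal_def
    using emeasure_distr[OF projection_measurable[OF assms(1,2)] assms(3)] by simp
qed

text \<open>A finite Baire measure on the limit is tight, tested on open Baire sets. Take compact sets \<open>K i\<close>
  whose outer measures under the marginals fall short of full measure by amounts summing to at
  most \<open>\<epsilon>\<close>; this uses that the index set is countable. The threads in \<open>\<Pi>\<^sub>E i\<in>J. K i\<close> form a compact set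
  \<open>C\<close>, and an open set containing \<open>C\<close> also contains all threads in some product of open sets
  \<open>U i \<supseteq> K i\<close>. The complement of the latter is controlled by the marginals alone.\<close>

lemma tight:
  assumes J: "countable J" and radon: "\<And>i. i \<in> J \<Longrightarrow> radon_space (Xs i)"
    and m: "finite_measure m" "sets m = sets (baire X)" and \<epsilon>: "0 < \<epsilon>"
  obtains K where "compactin X K"
    "\<And>A. A \<in> sets m \<Longrightarrow> openin X A \<Longrightarrow> K \<subseteq> A \<Longrightarrow> measure m (topspace X - A) \<le> \<epsilon>"
proof -
  let ?T = "threads J leq (\<lambda>i. topspace (Xs i)) p"
  interpret finite_measure m by (rule m(1))
  have space_m: "space m = topspace X"
    using sets_eq_imp_space_eq[OF m(2)] by simp
  define e where "e i = \<epsilon> * (1 / 2) ^ Suc (to_nat_on J i)" for i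
  have e: "0 < e i" for i using \<epsilon> by (simp add: e_def)
  have "\<exists>K. compactin (Xs i) K \<and>
      emeasure (marginal m i) (topspace (Xs i)) < outer_measure_of (marginal m i) K + e i" if i: "i \<in> J" for i
  proof -
    interpret \<mu>: finite_measure "marginal m i"
      using finite_measure_marginal[OF m i] .
    have "radon_measure (Xs i) (marginal m i)"
      using radon[OF i] \<mu>.finite_measure_axioms by (simp add: radon_space_def)
    moreover have "topspace (Xs i) \<in> sets (marginal m i)"
      using sets.top[of "baire (Xs i)"] by simp
    ultimately have "emeasure (marginal m i) (topspace (Xs i)) =
        (SUP K\<in>{K. compactin (Xs i) K \<and> K \<subseteq> topspace (Xs i)}. outer_measure_of (marginal m i) K)"
      by (simp add: radon_measure_def)
    from SUP_approx_ennreal[OF e _ this] show ?thesis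
      using compactin_empty by fastforce
  qed
  then obtain K where K: "\<And>i. i \<in> J \<Longrightarrow> compactin (Xs i) (K i)"
      "\<And>i. i \<in> J \<Longrightarrow> emeasure (marginal m i) (topspace (Xs i)) < outer_measure_of (marginal m i) (K i) + e i"
    by metis
  define C where "C = {x \<in> topspace X. \<phi> x \<in> PiE J K}"
  have image_C: "\<phi> ` C = PiE J K \<inter> ?T"
    using \<phi>_image by (auto simp: C_def)
  have "compactin (product_topology Xs J) (PiE J K \<inter> ?T)"
    using K(1) closedin_threads by (intro compact_Int_closedin) (auto simp: compactin_PiE)
  then have "compactin (lim_space J leq Xs p) (\<phi> ` C)"
    by (simp add: lim_space_def compactin_subtopology image_C)
  then have C: "compactin X C"
    using homeomorphic_map_compactness[OF limit, of C] by (auto simp: C_def)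
  show thesis
  proof (rule that[OF C])
    fix A assume A: "A \<in> sets m" "openin X A" "C \<subseteq> A"
    have "openin (lim_space J leq Xs p) (\<phi> ` A)"
      using limit A(2) by (simp add: homeomorphic_eq_everything_map open_map_def)
    then obtain W where W: "openin (product_topology Xs J) W" "\<phi> ` A = W \<inter> ?T"
      unfolding lim_space_def openin_subtopology by blast
    \<comment> \<open>Adding the complement of the closed set of threads makes \<open>W\<close> contain the whole product of
      the compact sets.\<close>
    let ?W = "W \<union> (topspace (product_topology Xs J) - ?T)"
    have "openin (product_topology Xs J) ?W"
      using W(1) closedin_threads by (intro openin_Un openin_diff openin_topspace)
    moreover have "PiE J K \<subseteq> ?W"
    proof
      fix y assume y: "y \<in> PiE J K"
      have "y \<in> topspace (product_topology Xs J)"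
        using y K(1)[THEN compactin_subset_topspace] by (auto simp: PiE_iff)
      moreover have "y \<in> W" if "y \<in> ?T"
      proof -
        have "y \<in> \<phi> ` C" using that y image_C by blast
        then have "y \<in> \<phi> ` A" using A(3) by blast
        then show ?thesis using W(2) by blast
      qed
      ultimately show "y \<in> ?W" by blast
    qed
    ultimately obtain U where U: "\<And>i. i \<in> J \<Longrightarrow> openin (Xs i) (U i)" "\<And>i. i \<in> J \<Longrightarrow> K i \<subseteq> U i"
        "PiE J U \<subseteq> ?W"
      using compact_box_neighbourhood[of J Xs K] K(1) by blast
    \<comment> \<open>Neither \<open>K i\<close> nor \<open>U i\<close> need be a Baire set; a zero set between them is one.\<close>
    have "\<exists>Z. Z \<in> sets (baire (Xs i)) \<and> K i \<subseteq> Z \<and> Z \<subseteq> U i" if i: "i \<in> J" for i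
    proof -
      have "completely_regular_space (Xs i)"
        using Tychonoff[OF i] by (simp add: Tychonoff_space_def)
      moreover have "closedin (Xs i) (topspace (Xs i) - U i)"
        using U(1)[OF i] by blast
      moreover have "disjnt (K i) (topspace (Xs i) - U i)"
        using U(2)[OF i] by (auto simp: disjnt_def)
      ultimately obtain f :: "'a \<Rightarrow> real" where f: "continuous_map (Xs i) euclideanreal f"
          "f ` K i \<subseteq> {0}" "f ` (topspace (Xs i) - U i) \<subseteq> {1}"
        using Urysohn_completely_regular_compact_closed_alt[OF _ K(1)[OF i]] by metis
      have "{x \<in> topspace (Xs i). f x = 0} \<in> sets (baire (Xs i))"
        using zero_set_of_real[OF f(1)] by (auto simp: sets_baire)
      then show ?thesis
        using f(2,3) compactin_subset_topspace[OF K(1)[OF i]]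
        by (intro exI[of _ "{x \<in> topspace (Xs i). f x = 0}"]) auto
    qed
    then obtain Z where Z: "\<And>i. i \<in> J \<Longrightarrow> Z i \<in> sets (baire (Xs i))"
        "\<And>i. i \<in> J \<Longrightarrow> K i \<subseteq> Z i" "\<And>i. i \<in> J \<Longrightarrow> Z i \<subseteq> U i"
      by metis
    define B where "B i = {x \<in> topspace X. \<phi> x i \<in> topspace (Xs i) - Z i}" for i
    have B: "B i \<in> sets m" "measure m (B i) \<le> e i" if i: "i \<in> J" for i
    proof -
      interpret \<mu>: finite_measure "marginal m i"
        using finite_measure_marginal[OF m i] .
      have sp: "space (marginal m i) = topspace (Xs i)"
        using sets_eq_imp_space_eq[OF sets_marginal, of m i] by simp
      have Zi: "Z i \<in> sets (marginal m i)" "topspace (Xs i) - Z i \<in> sets (baire (Xs i))"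
        using Z(1)[OF i] sets.compl_sets[OF Z(1)[OF i]] by simp_all
      have "B i = (\<lambda>x. \<phi> x i) -` (topspace (Xs i) - Z i) \<inter> space m"
        by (auto simp: B_def space_m)
      then show "B i \<in> sets m"
        using measurable_sets[OF projection_measurable[OF m(2) i] Zi(2)] by simp
      have "outer_measure_of (marginal m i) (K i) \<le> emeasure (marginal m i) (Z i)"
        using outer_measure_of_mono[OF Z(2)[OF i], of "marginal m i"] outer_measure_of_eq[OF Zi(1)] by simp
      then have "emeasure (marginal m i) (topspace (Xs i)) < emeasure (marginal m i) (Z i) + e i"
        using K(2)[OF i] by (meson add_right_mono order_less_le_trans)
      then have "measure (marginal m i) (topspace (Xs i)) < measure (marginal m i) (Z i) + e i"
        using e[of i] by (simp add: \<mu>.emeasure_eq_measure ennreal_less_iff flip: ennreal_plus)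
      then have "measure (marginal m i) (topspace (Xs i) - Z i) < e i"
        using \<mu>.finite_measure_compl[OF Zi(1)] by (simp add: sp)
      moreover have "emeasure m (B i) = emeasure (marginal m i) (topspace (Xs i) - Z i)"
        unfolding B_def using emeasure_marginal[OF m(2) i Zi(2)] by simp
      ultimately show "measure m (B i) \<le> e i"
        by (simp add: measure_def)
    qed
    have cover: "topspace X - A \<subseteq> (\<Union>i\<in>J. B i)"
    proof
      fix x assume x: "x \<in> topspace X - A"
      show "x \<in> (\<Union>i\<in>J. B i)"
      proof (rule ccontr)
        assume "x \<notin> (\<Union>i\<in>J. B i)"
        then have "\<phi> x i \<in> U i" if "i \<in> J" for i
          using that x Z(3)[OF that] projection_in[OF that] by (auto simp: B_def)
        moreover have xT: "\<phi> x \<in> ?T" using \<phi>_thread x by blast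
        ultimately have "\<phi> x \<in> PiE J U"
          by (auto simp: threads_def PiE_iff)
        then have "\<phi> x \<in> \<phi> ` A"
          using U(3) W(2) xT by blast
        then have "x \<in> A"
          using x inj_\<phi> openin_subset[OF A(2)] by (auto simp: inj_on_def)
        then show False using x by blast
      qed
    qed
    define D where "D n = (if n \<in> to_nat_on J ` J then B (from_nat_into J n) else {})" for n
    have D: "D n \<in> sets m" "measure m (D n) \<le> \<epsilon> * (1 / 2) ^ Suc n" for n
    proof -
      show "D n \<in> sets m"
        using B(1) J by (auto simp: D_def)
      show "measure m (D n) \<le> \<epsilon> * (1 / 2) ^ Suc n"
        using B(2) J \<epsilon> by (auto simp: D_def e_def)
    qed
    have "(\<Union>i\<in>J. B i) \<subseteq> (\<Union>n. D n)"
    proof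
      fix x assume "x \<in> (\<Union>i\<in>J. B i)"
      then obtain i where "i \<in> J" "x \<in> B i" by blast
      then have "x \<in> D (to_nat_on J i)"
        using J by (simp add: D_def)
      then show "x \<in> (\<Union>n. D n)" by blast
    qed
    have series: "(\<lambda>n. \<epsilon> * (1 / 2) ^ Suc n) sums (\<epsilon> * 1)"
      by (intro sums_mult power_half_series)
    then have sm: "summable (\<lambda>n. measure m (D n))"
      using D(2) by (intro summable_comparison_test'[OF sums_summable[OF series], of 0]) auto
    have "measure m (topspace X - A) \<le> measure m (\<Union>n. D n)"
      using cover \<open>(\<Union>i\<in>J. B i) \<subseteq> (\<Union>n. D n)\<close> D(1) by (intro finite_measure_mono) auto
    also have "measure m (\<Union>n. D n) \<le> (\<Sum>n. measure m (D n))"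
      using D(1) sm by (intro finite_measure_subadditive_countably) auto
    also have "\<dots> \<le> \<epsilon>"
      using suminf_le[OF D(2) sm sums_summable[OF series]] sums_unique[OF series] by simp
    finally show "measure m (topspace X - A) \<le> \<epsilon>" .
  qed
qed

text \<open>The comparison of integrals only needs \<open>u \<le> f\<close> on the whole space: it bounds \<open>\<integral>f\<close> from below by
  \<open>\<integral>u\<close> for every measure, not only for \<open>m\<close>. The shift by \<open>b\<close> makes \<open>f\<close> non-negative.\<close>

lemma cylinder_lower_approximation:
  assumes "J \<noteq> {}" "countable J" "\<And>i. i \<in> J \<Longrightarrow> radon_space (Xs i)"
    and m: "finite_measure m" "sets m = sets (baire X)"
    and f: "continuous_map X euclideanreal f" "bounded (f ` topspace X)" and \<epsilon>: "0 < \<epsilon>"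
  obtains u where "cylinder u" "\<And>x. x \<in> topspace X \<Longrightarrow> u x \<le> f x" "(\<integral>x. f x \<partial>m) < (\<integral>x. u x \<partial>m) + \<epsilon>"
proof -
  interpret finite_measure m by (rule m(1))
  have space_m: "space m = topspace X"
    using sets_eq_imp_space_eq[OF m(2)] by simp
  obtain b where b: "0 < b" "\<And>x. x \<in> topspace X \<Longrightarrow> \<bar>f x\<bar> \<le> b"
    using f(2) by (auto simp: bounded_pos)
  define M where "M = measure m (topspace X)"
  define \<delta> where "\<delta> = \<epsilon> / (M + 2 * b + 1)"
  have M: "0 \<le> M" by (simp add: M_def)
  have \<delta>: "0 < \<delta>" "\<delta> * M + 2 * b * \<delta> < \<epsilon>"
  proof -
    show "0 < \<delta>" using M b(1) \<epsilon> by (simp add: \<delta>_def)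
    have "\<delta> * (M + 2 * b + 1) = \<epsilon>" using M b(1) by (simp add: \<delta>_def)
    then show "\<delta> * M + 2 * b * \<delta> < \<epsilon>"
      using \<open>0 < \<delta>\<close> by (simp add: algebra_simps)
  qed
  obtain K where K: "compactin X K"
    "\<And>A. A \<in> sets m \<Longrightarrow> openin X A \<Longrightarrow> K \<subseteq> A \<Longrightarrow> measure m (topspace X - A) \<le> \<delta>"
    using tight[OF assms(2,3) m \<delta>(1)] by blast
  have fb: "continuous_map X euclideanreal (\<lambda>x. f x + b)"
    using f(1) by (intro continuous_intros) auto
  obtain u where u: "cylinder u" "\<And>x. x \<in> topspace X \<Longrightarrow> 0 \<le> u x" "\<And>x. x \<in> topspace X \<Longrightarrow> u x \<le> f x + b"
    "\<And>x. x \<in> K \<Longrightarrow> f x + b < u x + \<delta>"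
  proof (rule cylinder_approximation[OF assms(1) fb _ K(1) \<delta>(1)])
    show "0 \<le> f x + b" if "x \<in> topspace X" for x using b(2)[OF that] by linarith
  qed blast
  define A where "A = {x \<in> topspace X. f x + b - u x < \<delta>}"
  have cont: "continuous_map X euclideanreal (\<lambda>x. f x + b - u x)"
    using fb cylinder_continuous(1)[OF u(1)] by (rule continuous_map_diff)
  have "openin X A"
    using cont unfolding A_def continuous_map_upper_lower_semicontinuous_lt by blast
  moreover have A: "A \<in> sets m"
  proof -
    have "(\<lambda>x. f x + b - u x) \<in> borel_measurable m"
      using continuous_real_measurable[OF cont] m(2) by (simp cong: measurable_cong_sets)
    then have "{x \<in> space m. f x + b - u x < \<delta>} \<in> sets m"
      by measurable
    then show ?thesis by (simp add: A_def space_m)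
  qed
  moreover have "K \<subseteq> A"
    using u(4) compactin_subset_topspace[OF K(1)] by (force simp: A_def)
  ultimately have mA: "measure m (topspace X - A) \<le> \<delta>"
    using K(2) by blast
  have cA: "topspace X - A \<in> sets m"
    using sets.compl_sets[OF A] by (simp add: space_m)
  have int_f: "integrable m f"
    using continuous_integrable[OF m f] .
  have int_u: "integrable m u"
    using continuous_integrable[OF m cylinder_continuous[OF u(1)]] .
  have int_A: "integrable m (indicat_real (topspace X - A))"
    using cA by (intro integrable_real_indicator) (simp_all add: emeasure_eq_measure)
  have "(\<integral>x. f x + b \<partial>m) \<le> (\<integral>x. u x + \<delta> + 2 * b * indicat_real (topspace X - A) x \<partial>m)"
  proof (rule integral_mono)
    fix x assume "x \<in> space m"
    then have x: "x \<in> topspace X" by (simp add: space_m)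
    show "f x + b \<le> u x + \<delta> + 2 * b * indicat_real (topspace X - A) x"
      using b(2)[OF x] u(2)[OF x] \<delta>(1) x by (cases "x \<in> A") (auto simp: A_def)
  qed (use int_f int_u int_A in auto)
  also have "\<dots> = (\<integral>x. u x \<partial>m) + \<delta> * M + 2 * b * measure m (topspace X - A)"
    using int_u int_A cA by (simp add: M_def space_m Int_absorb2)
  also have "\<dots> \<le> (\<integral>x. u x \<partial>m) + \<delta> * M + 2 * b * \<delta>"
    using mA b(1) by simp
  also have "\<dots> < (\<integral>x. u x \<partial>m) + \<epsilon>"
    using \<delta>(2) by simp
  finally have less: "(\<integral>x. f x \<partial>m) < (\<integral>x. u x - b \<partial>m) + \<epsilon>"
    using int_f int_u by simp
  show thesis
  proof (rule that)
    show "cylinder (\<lambda>x. u x - b)"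
      using cylinder_affine[OF u(1), of 1 "- b"] by simp
    show "u x - b \<le> f x" if "x \<in> topspace X" for x
      using u(3)[OF that] by simp
  qed (rule less)
qed

end

context inverse_limit_space
begin

lemma integral_marginal:
  fixes f :: "'a \<Rightarrow> 'b::{banach, second_countable_topology}"
  assumes "sets m = sets (baire X)" "i \<in> J" "f \<in> borel_measurable (baire (Xs i))"
  shows "(\<integral>z. f z \<partial>marginal m i) = (\<integral>x. f (\<phi> x i) \<partial>m)"
  unfolding marginal_def
  using integral_distr[OF projection_measurable[OF assms(1,2)] assms(3)] .

lemma integral_cylinder_cong:
  assumes m: "sets m = sets (baire X)" and m': "sets m' = sets (baire X)"
    and eq: "\<And>i. i \<in> J \<Longrightarrow> marginal m i = marginal m' i" and "cylinder u"
  shows "(\<integral>x. u x \<partial>m) = (\<integral>x. u x \<partial>m')"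
proof -
  obtain i g where u: "i \<in> J" "continuous_map (Xs i) euclideanreal g" "bounded (g ` topspace (Xs i))"
      "\<And>x. x \<in> topspace X \<Longrightarrow> u x = g (\<phi> x i)"
    using cylinderE[OF assms(4)] by blast
  have *: "(\<integral>x. u x \<partial>\<nu>) = (\<integral>z. g z \<partial>marginal \<nu> i)" if \<nu>: "sets \<nu> = sets (baire X)" for \<nu>
  proof -
    have "(\<integral>x. u x \<partial>\<nu>) = (\<integral>x. g (\<phi> x i) \<partial>\<nu>)"
      using sets_eq_imp_space_eq[OF \<nu>] u(4) by (intro Bochner_Integration.integral_cong) auto
    then show ?thesis
      using integral_marginal[OF \<nu> u(1) continuous_real_measurable[OF u(2)]] by simp
  qed
  show ?thesis
    using *[OF m] *[OF m'] eq[OF u(1)] by simp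
qed

text \<open>The preimages of Baire sets of the \<open>Xs i\<close> may generate a smaller \<open>\<sigma>\<close>-algebra than the Baire sets
  of the limit, so uniqueness comes from tightness.\<close>

lemma marginals_determine_measure:
  assumes J: "J \<noteq> {}" "countable J" and radon: "\<And>i. i \<in> J \<Longrightarrow> radon_space (Xs i)"
    and m: "finite_measure m" "sets m = sets (baire X)"
    and m': "finite_measure m'" "sets m' = sets (baire X)"
    and eq: "\<And>i. i \<in> J \<Longrightarrow> marginal m i = marginal m' i"
  shows "m = m'"
proof (rule baire_measure_eqI[OF m m'])
  fix f assume f: "continuous_map X euclideanreal f" "bounded (f ` topspace X)"
  have le: "(\<integral>x. f x \<partial>\<mu>) \<le> (\<integral>x. f x \<partial>\<nu>)"
    if \<mu>: "finite_measure \<mu>" "sets \<mu> = sets (baire X)" and \<nu>: "finite_measure \<nu>" "sets \<nu> = sets (baire X)"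
      and eq': "\<And>i. i \<in> J \<Longrightarrow> marginal \<mu> i = marginal \<nu> i" for \<mu> \<nu>
  proof (rule field_le_epsilon)
    fix e :: real assume "0 < e"
    then obtain u where u: "cylinder u" "\<And>x. x \<in> topspace X \<Longrightarrow> u x \<le> f x"
        "(\<integral>x. f x \<partial>\<mu>) < (\<integral>x. u x \<partial>\<mu>) + e"
      using cylinder_lower_approximation[OF J radon \<mu> f] by blast
    have "(\<integral>x. u x \<partial>\<mu>) = (\<integral>x. u x \<partial>\<nu>)"
      using integral_cylinder_cong[OF \<mu>(2) \<nu>(2) eq' u(1)] by blast
    also have "\<dots> \<le> (\<integral>x. f x \<partial>\<nu>)"
      using u(2) sets_eq_imp_space_eq[OF \<nu>(2)]
      by (intro integral_mono continuous_integrable[OF \<nu>] f cylinder_continuous[OF u(1)]) auto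
    finally show "(\<integral>x. f x \<partial>\<mu>) \<le> (\<integral>x. f x \<partial>\<nu>) + e"
      using u(3) by linarith
  qed
  show "(\<integral>x. f x \<partial>m) = (\<integral>x. f x \<partial>m')"
    using le[OF m m' eq] le[OF m' m eq[symmetric]] by simp
qed

end

section \<open>Quasi-invariant measures on the limit\<close>

lemma sets_translate [simp]: "sets (translate a g m) = sets m"
  by (simp add: translate_def)

lemma
  assumes "admissible_action H Y a" "g \<in> carrier H" "finite_measure m" "sets m = sets (baire Y)"
  shows action_measurable: "a g \<in> measurable m m"
    and finite_measure_translate: "finite_measure (translate a g m)"
proof -
  show *: "a g \<in> measurable m m"
    using admissible_action_measurable[OF assms(1,2)] assms(4) by (simp cong: measurable_cong_sets)
  show "finite_measure (translate a g m)"
    unfolding translate_def using finite_measure.finite_measure_distr[OF assms(3) *] .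
qed

lemma topspace_PQ_space: "topspace (PQ_space F Y H a) = PQplus Y H a"
  by (auto simp: PQ_space_def topspace_tau_w PQplus_def)

lemma continuous_map_complexI:
  assumes "continuous_map Z euclideanreal (\<lambda>z. Re (c z))" "continuous_map Z euclideanreal (\<lambda>z. Im (c z))"
  shows "continuous_map Z euclidean c"
proof -
  have "continuous_map Z (prod_topology euclideanreal euclideanreal) (\<lambda>z. (Re (c z), Im (c z)))"
    using assms by (rule continuous_map_pairedI)
  moreover have "continuous_map (prod_topology euclideanreal euclideanreal) euclidean (\<lambda>(x, y). Complex x y)"
    by (auto simp: Complex_eq case_prod_unfold intro!: continuous_intros)
  ultimately have "continuous_map Z euclidean ((\<lambda>(x, y). Complex x y) \<circ> (\<lambda>z. (Re (c z), Im (c z))))"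
    by (rule continuous_map_compose)
  then show ?thesis by (simp add: o_def)
qed

text \<open>A group of families of elements of the \<open>Gs i\<close>, acting on the \<open>i\<close>-th coordinate through the \<open>i\<close>-th
  component. The actions are not assumed continuous.\<close>

locale inverse_limit_action = inverse_limit_space J leq Xs p X \<phi>
  for J :: "'i set" and leq :: "'i \<Rightarrow> 'i \<Rightarrow> bool"
    and Xs :: "'i \<Rightarrow> 'a topology" and p :: "'i \<Rightarrow> 'i \<Rightarrow> 'a \<Rightarrow> 'a"
    and X :: "'x topology" and \<phi> :: "'x \<Rightarrow> 'i \<Rightarrow> 'a" +
  fixes F :: "complex set"
    and Gs :: "'i \<Rightarrow> 'g monoid" and as :: "'i \<Rightarrow> 'g \<Rightarrow> 'a \<Rightarrow> 'a"
    and G :: "('i \<Rightarrow> 'g) monoid" and act :: "('i \<Rightarrow> 'g) \<Rightarrow> 'x \<Rightarrow> 'x"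
  assumes field: "F = \<real> \<or> F = UNIV"
    and actions: "\<And>i. i \<in> J \<Longrightarrow> admissible_action (Gs i) (Xs i) (as i)"
    and action: "admissible_action G X act"
    and compatible: "\<And>i g x. \<lbrakk>i \<in> J; g \<in> carrier G; x \<in> topspace X\<rbrakk>
        \<Longrightarrow> \<phi> (act g x) i = as i (g i) (\<phi> x i)"
    and onto: "\<And>i. i \<in> J \<Longrightarrow> (\<lambda>g. g i) ` carrier G = carrier (Gs i)"
    and radon: "\<And>i. i \<in> J \<Longrightarrow> radon_space (Xs i)"
    and countable: "countable J"
begin

lemma component_in: "i \<in> J \<Longrightarrow> g \<in> carrier G \<Longrightarrow> g i \<in> carrier (Gs i)"
  using onto by blast

lemma translate_marginal:
  assumes m: "finite_measure m" "sets m = sets (baire X)" and i: "i \<in> J" and g: "g \<in> carrier G"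
  shows "translate (as i) (g i) (marginal m i) = marginal (translate act g m) i"
proof -
  have \<pi>: "(\<lambda>x. \<phi> x i) \<in> measurable m (baire (Xs i))"
    using projection_measurable[OF m(2) i] .
  have a: "as i (g i) \<in> measurable (baire (Xs i)) (baire (Xs i))"
    using admissible_action_measurable[OF actions[OF i] component_in[OF i g]] .
  have act_m: "act g \<in> measurable m m"
    using action_measurable[OF action g m] .
  have "translate (as i) (g i) (marginal m i) = distr (marginal m i) (baire (Xs i)) (as i (g i))"
    unfolding translate_def by (rule distr_cong) auto
  also have "\<dots> = distr m (baire (Xs i)) (as i (g i) \<circ> (\<lambda>x. \<phi> x i))"
    unfolding marginal_def by (rule distr_distr[OF a \<pi>])
  also have "\<dots> = distr m (baire (Xs i)) ((\<lambda>x. \<phi> x i) \<circ> act g)"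
    using compatible[OF i g] sets_eq_imp_space_eq[OF m(2)] by (intro distr_cong) auto
  also have "\<dots> = marginal (translate act g m) i"
    unfolding marginal_def translate_def by (rule distr_distr[OF \<pi> act_m, symmetric])
  finally show ?thesis .
qed

text \<open>Every element of \<open>Gs i\<close> is a component of an element of \<open>G\<close>, so quasi-invariance passes to the
  marginals, relative to all of \<open>Gs i\<close>.\<close>

lemma marginal_Qplus:
  assumes "m \<in> Qplus X G act" and i: "i \<in> J"
  shows "marginal m i \<in> Qplus (Xs i) (Gs i) (as i)"
proof -
  have m: "finite_measure m" "sets m = sets (baire X)"
    and q: "\<And>g. g \<in> carrier G \<Longrightarrow> null_sets (translate act g m) = null_sets m"
    using assms(1) by (auto simp: Qplus_def)
  have null: "A \<in> null_sets (marginal \<nu> i) \<longleftrightarrow>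
      (\<lambda>x. \<phi> x i) -` A \<inter> topspace X \<in> null_sets \<nu> \<and> A \<in> sets (baire (Xs i))"
    if \<nu>: "sets \<nu> = sets (baire X)" for A \<nu>
    unfolding marginal_def null_sets_distr_iff[OF projection_measurable[OF \<nu> i]]
    using sets_eq_imp_space_eq[OF \<nu>] by simp
  have "null_sets (translate (as i) h (marginal m i)) = null_sets (marginal m i)"
    if "h \<in> carrier (Gs i)" for h
  proof -
    obtain g where g: "g \<in> carrier G" "h = g i"
      using onto[OF i] \<open>h \<in> carrier (Gs i)\<close> by blast
    have "null_sets (marginal (translate act g m) i) = null_sets (marginal m i)"
      using null[OF m(2)] null[of "translate act g m"] m(2) q[OF g(1)] by auto
    then show ?thesis
      using translate_marginal[OF m i g(1)] g(2) by simp
  qed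
  then show ?thesis
    using finite_measure_marginal[OF m i] by (simp add: Qplus_def)
qed

lemma marginal_PQplus:
  assumes "m \<in> PQplus X G act" and i: "i \<in> J"
  shows "marginal m i \<in> PQplus (Xs i) (Gs i) (as i)"
proof -
  have m: "m \<in> Qplus X G act" "sets m = sets (baire X)" "emeasure m (topspace X) = 1"
    using assms(1) by (auto simp: PQplus_def Qplus_def)
  have "{x \<in> topspace X. \<phi> x i \<in> topspace (Xs i)} = topspace X"
    using projection_in[OF i] by auto
  then have "emeasure (marginal m i) (topspace (Xs i)) = 1"
    using emeasure_marginal[OF m(2) i, of "topspace (Xs i)"] sets.top[of "baire (Xs i)"] m(3) by simp
  then show ?thesis
    using marginal_Qplus[OF m(1) i] by (simp add: PQplus_def)
qed

lemma marginals_consistent: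
  assumes m: "sets m = sets (baire X)" and ij: "i \<in> J" "j \<in> J" "leq j i" and B: "B \<in> sets (baire (Xs j))"
  shows "emeasure (marginal m i) (p i j -` B \<inter> topspace (Xs i)) = emeasure (marginal m j) B"
proof -
  have "p i j -` B \<inter> topspace (Xs i) \<in> sets (baire (Xs i))"
    using measurable_sets[OF continuous_map_baire_measurable[OF bonding_continuous[OF ij]] B] by simp
  moreover have "{x \<in> topspace X. \<phi> x i \<in> p i j -` B \<inter> topspace (Xs i)} = {x \<in> topspace X. \<phi> x j \<in> B}"
    using projection_in[OF ij(1)] bonding_projection[OF ij] by auto
  ultimately show ?thesis
    using emeasure_marginal[OF m ij(1)] emeasure_marginal[OF m ij(2) B] by simp
qed

lemma marginal_continuous:
  assumes i: "i \<in> J"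
  shows "continuous_map (tau_w F X G act) (tau_w F (Xs i) (Gs i) (as i)) (\<lambda>m. marginal m i)"
proof (rule continuous_map_into_tau_w)
  show "marginal m i \<in> Qplus (Xs i) (Gs i) (as i)" if "m \<in> topspace (tau_w F X G act)" for m
    using marginal_Qplus[OF _ i] that by (simp add: topspace_tau_w)
  fix f h assume f: "f \<in> Cb (Xs i) F" and h: "h \<in> carrier (Gs i)"
  obtain g where g: "g \<in> carrier G" "h = g i"
    using onto[OF i] h by blast
  show "continuous_map (tau_w F X G act) euclidean (\<lambda>m. \<integral>x. f x \<partial>translate (as i) h (marginal m i))"
  proof (rule continuous_map_eq)
    show "continuous_map (tau_w F X G act) euclidean (\<lambda>m. \<integral>x. f (\<phi> x i) \<partial>translate act g m)"
      using continuous_map_tau_w_integral[OF Cb_compose[OF projection_continuous[OF i] f] g(1)] .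
    fix m assume "m \<in> topspace (tau_w F X G act)"
    then have m: "finite_measure m" "sets m = sets (baire X)"
      by (auto simp: topspace_tau_w Qplus_def)
    show "(\<integral>x. f (\<phi> x i) \<partial>translate act g m) = (\<integral>x. f x \<partial>translate (as i) h (marginal m i))"
      using integral_marginal[OF _ i Cb_measurable[OF f], of "translate act g m"] m
        translate_marginal[OF m i g(1)] g(2) by simp
  qed
qed

text \<open>The family of all marginals, extended by \<open>undefined\<close> off \<open>J\<close> so that it lies in \<open>\<Pi>\<^sub>E i\<in>J\<close>.\<close>

definition marginals :: "'x measure \<Rightarrow> 'i \<Rightarrow> 'a measure" where
  "marginals m = (\<lambda>i\<in>J. marginal m i)"

lemma marginals_continuous:
  "continuous_map (PQ_space F X G act) (lim_PQ_space F J leq Xs p Gs as) marginals"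
  unfolding lim_PQ_space_def continuous_map_in_subtopology
proof (intro conjI)
  show "continuous_map (PQ_space F X G act)
      (product_topology (\<lambda>i. PQ_space F (Xs i) (Gs i) (as i)) J) marginals"
    unfolding continuous_map_componentwise
  proof (intro conjI ballI)
    show "marginals ` topspace (PQ_space F X G act) \<subseteq> extensional J"
      by (auto simp: marginals_def)
    fix i assume i: "i \<in> J"
    have "continuous_map (PQ_space F X G act) (PQ_space F (Xs i) (Gs i) (as i)) (\<lambda>m. marginal m i)"
      unfolding PQ_space_def[of _ "Xs i"] continuous_map_in_subtopology
    proof
      show "continuous_map (PQ_space F X G act) (tau_w F (Xs i) (Gs i) (as i)) (\<lambda>m. marginal m i)"
        unfolding PQ_space_def by (rule continuous_map_from_subtopology[OF marginal_continuous[OF i]])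
      show "(\<lambda>m. marginal m i) \<in> topspace (PQ_space F X G act) \<rightarrow> PQplus (Xs i) (Gs i) (as i)"
        using marginal_PQplus[OF _ i] by (auto simp: topspace_PQ_space)
    qed
    then show "continuous_map (PQ_space F X G act) (PQ_space F (Xs i) (Gs i) (as i)) (\<lambda>m. marginals m i)"
      using i by (simp add: marginals_def)
  qed
  show "marginals \<in> topspace (PQ_space F X G act) \<rightarrow> {\<mu> \<in> (\<Pi>\<^sub>E i\<in>J. PQplus (Xs i) (Gs i) (as i)).
      \<forall>i\<in>J. \<forall>j\<in>J. leq j i \<longrightarrow> (\<forall>B\<in>sets (baire (Xs j)).
        emeasure (\<mu> i) (p i j -` B \<inter> topspace (Xs i)) = emeasure (\<mu> j) B)}"
  proof
    fix m assume "m \<in> topspace (PQ_space F X G act)"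
    then have m: "m \<in> PQplus X G act" "sets m = sets (baire X)"
      by (auto simp: topspace_PQ_space PQplus_def Qplus_def)
    show "marginals m \<in> {\<mu> \<in> (\<Pi>\<^sub>E i\<in>J. PQplus (Xs i) (Gs i) (as i)).
      \<forall>i\<in>J. \<forall>j\<in>J. leq j i \<longrightarrow> (\<forall>B\<in>sets (baire (Xs j)).
        emeasure (\<mu> i) (p i j -` B \<inter> topspace (Xs i)) = emeasure (\<mu> j) B)}"
      using marginal_PQplus[OF m(1)] marginals_consistent[OF m(2)] by (auto simp: marginals_def)
  qed
qed

text \<open>For empty \<open>J\<close> there are no cylinder functions, but then the limit has at most one point.\<close>

lemma PQplus_empty_index:
  assumes "J = {}" "m \<in> PQplus X G act" "m' \<in> PQplus X G act"
  shows "m = m'"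
proof (rule measure_eqI)
  have m: "sets m = sets (baire X)" "emeasure m (topspace X) = 1"
    and m': "sets m' = sets (baire X)" "emeasure m' (topspace X) = 1"
    using assms(2,3) by (auto simp: PQplus_def Qplus_def)
  show "sets m = sets m'" using m m' by simp
  fix A assume "A \<in> sets m"
  then have A: "A \<subseteq> topspace X"
    using m(1) sets.sets_into_space[of A "baire X"] by simp
  have "x = y" if "x \<in> topspace X" "y \<in> topspace X" for x y
    using that inj_\<phi> \<phi>_thread assms(1) by (auto simp: threads_def inj_on_def)
  then have "A = {} \<or> A = topspace X"
    using A by blast
  then show "emeasure m A = emeasure m' A"
    using m(2) m'(2) by auto
qed

lemma inj_marginals: "inj_on marginals (PQplus X G act)"
proof (rule inj_onI)
  fix m m' assume mm': "m \<in> PQplus X G act" "m' \<in> PQplus X G act" "marginals m = marginals m'"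
  have "marginal m i = marginal m' i" if "i \<in> J" for i
    using fun_cong[OF mm'(3), of i] that by (simp add: marginals_def)
  then show "m = m'"
    using marginals_determine_measure[OF _ countable radon, of m m'] PQplus_empty_index[OF _ mm'(1,2)] mm'(1,2)
    by (cases "J = {}") (auto simp: PQplus_def Qplus_def)
qed

text \<open>For a cylinder function \<open>u\<close> the integral against a translate is a continuous function of one
  marginal. By \<open>cylinder_lower_approximation\<close>, applied to the translated measure, the integral of a
  bounded continuous \<open>f\<close> is a supremum of such functions, hence lower semicontinuous; applied to
  \<open>-f\<close>, it is upper semicontinuous.\<close>

lemma marginals_inverse_continuous:
  assumes k: "\<And>m. m \<in> PQplus X G act \<Longrightarrow> k (marginals m) = m"
  shows "continuous_map (subtopology (lim_PQ_space F J leq Xs p Gs as) (marginals ` PQplus X G act))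
    (PQ_space F X G act) k"
proof -
  let ?P = "PQplus X G act"
  let ?Z = "subtopology (lim_PQ_space F J leq Xs p Gs as) (marginals ` ?P)"
  have Z: "z \<in> marginals ` ?P" if "z \<in> topspace ?Z" for z
    using that by simp
  have kP: "k z \<in> ?P" "marginals (k z) = z" if "z \<in> topspace ?Z" for z
    using Z[OF that] k by auto
  have kf: "finite_measure (k z)" "sets (k z) = sets (baire X)" if "z \<in> topspace ?Z" for z
    using kP(1)[OF that] by (auto simp: PQplus_def Qplus_def)
  have proj: "continuous_map ?Z (tau_w F (Xs i) (Gs i) (as i)) (\<lambda>z. z i)" if i: "i \<in> J" for i
  proof -
    have "continuous_map (product_topology (\<lambda>i. PQ_space F (Xs i) (Gs i) (as i)) J)
        (PQ_space F (Xs i) (Gs i) (as i)) (\<lambda>z. z i)"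
      using i by (rule continuous_map_product_projection)
    then have "continuous_map (product_topology (\<lambda>i. PQ_space F (Xs i) (Gs i) (as i)) J)
        (tau_w F (Xs i) (Gs i) (as i)) (\<lambda>z. z i)"
      unfolding PQ_space_def by (rule continuous_map_into_fulltopology)
    then show ?thesis
      unfolding lim_PQ_space_def by (intro continuous_map_from_subtopology)
  qed
  have real_cont: "continuous_map ?Z euclideanreal (\<lambda>z. \<integral>x. f x \<partial>translate act g (k z))"
    if f: "continuous_map X euclideanreal f" "bounded (f ` topspace X)" and g: "g \<in> carrier G" for f g
  proof (cases "J = {}")
    case True
    show ?thesis
    proof (cases "topspace ?Z = {}")
      case False
      then obtain z0 where z0: "z0 \<in> topspace ?Z" by blast
      show ?thesis
      proof (rule continuous_map_eq)
        show "continuous_map ?Z euclideanreal (\<lambda>z. \<integral>x. f x \<partial>translate act g (k z0))" by simp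
        fix z assume "z \<in> topspace ?Z"
        then show "(\<integral>x. f x \<partial>translate act g (k z0)) = (\<integral>x. f x \<partial>translate act g (k z))"
          using PQplus_empty_index[OF True kP(1)[OF z0] kP(1)] by simp
      qed
    qed (simp add: continuous_map_def)
  next
    case J: False
    have tf: "finite_measure (translate act g (k z))" "sets (translate act g (k z)) = sets (baire X)"
      if "z \<in> topspace ?Z" for z
      using finite_measure_translate[OF action g kf[OF that]] kf(2)[OF that] by auto
    have cylinder_cont: "continuous_map ?Z euclideanreal (\<lambda>z. \<integral>x. u x \<partial>translate act g (k z))"
      if cyl: "cylinder u" for u
    proof -
      obtain i h where u: "i \<in> J" "continuous_map (Xs i) euclideanreal h" "bounded (h ` topspace (Xs i))"
          "\<And>x. x \<in> topspace X \<Longrightarrow> u x = h (\<phi> x i)"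
        using cylinderE[OF cyl] by blast
      have "continuous_map (tau_w F (Xs i) (Gs i) (as i)) euclidean
          (\<lambda>m. \<integral>x. complex_of_real (h x) \<partial>translate (as i) (g i) m)"
        using continuous_map_tau_w_integral[OF Cb_of_real[OF u(2,3) field] component_in[OF u(1) g]] .
      from continuous_map_compose[OF proj[OF u(1)] this]
      have "continuous_map ?Z euclidean (\<lambda>z. complex_of_real (\<integral>x. h x \<partial>translate (as i) (g i) (z i)))"
        by (simp add: o_def)
      then have "continuous_map ?Z euclideanreal
          (Re \<circ> (\<lambda>z. complex_of_real (\<integral>x. h x \<partial>translate (as i) (g i) (z i))))"
        by (rule continuous_map_compose) (auto intro!: continuous_intros)
      then show ?thesis
      proof (rule continuous_map_eq)
        fix z assume z: "z \<in> topspace ?Z"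
        have "z i = marginal (k z) i"
          using fun_cong[OF kP(2)[OF z], of i] u(1) by (simp add: marginals_def)
        then have "(\<integral>x. h x \<partial>translate (as i) (g i) (z i)) = (\<integral>x. h x \<partial>marginal (translate act g (k z)) i)"
          using translate_marginal[OF kf[OF z] u(1) g] by simp
        also have "\<dots> = (\<integral>x. h (\<phi> x i) \<partial>translate act g (k z))"
          by (rule integral_marginal[OF tf(2)[OF z] u(1) continuous_real_measurable[OF u(2)]])
        also have "\<dots> = (\<integral>x. u x \<partial>translate act g (k z))"
          using sets_eq_imp_space_eq[OF tf(2)[OF z]] u(4)
          by (intro Bochner_Integration.integral_cong) auto
        finally show "(Re \<circ> (\<lambda>z. complex_of_real (\<integral>x. h x \<partial>translate (as i) (g i) (z i)))) z =
            (\<integral>x. u x \<partial>translate act g (k z))"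
          by simp
      qed
    qed
    have below: "\<exists>c. continuous_map ?Z euclideanreal c \<and>
        (\<forall>w\<in>topspace ?Z. c w \<le> (\<integral>x. f' x \<partial>translate act g (k w))) \<and>
        (\<integral>x. f' x \<partial>translate act g (k z)) < c z + e"
      if f': "continuous_map X euclideanreal f'" "bounded (f' ` topspace X)"
        and z: "z \<in> topspace ?Z" and e: "0 < e" for f' z e
    proof -
      obtain u where u: "cylinder u" "\<And>x. x \<in> topspace X \<Longrightarrow> u x \<le> f' x"
          "(\<integral>x. f' x \<partial>translate act g (k z)) < (\<integral>x. u x \<partial>translate act g (k z)) + e"
        using cylinder_lower_approximation[OF J countable radon tf[OF z] f' e] by blast
      have "(\<integral>x. u x \<partial>translate act g (k w)) \<le> (\<integral>x. f' x \<partial>translate act g (k w))"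
        if w: "w \<in> topspace ?Z" for w
        using u(2) sets_eq_imp_space_eq[OF tf(2)[OF w]]
        by (intro integral_mono continuous_integrable[OF tf[OF w]] f' cylinder_continuous[OF u(1)]) auto
      then show ?thesis
        using cylinder_cont[OF u(1)] u(3) by blast
    qed
    show ?thesis
    proof (rule continuous_map_real_sandwich)
      fix z and e :: real assume z: "z \<in> topspace ?Z" and e: "0 < e"
      show "\<exists>c. continuous_map ?Z euclideanreal c \<and>
          (\<forall>w\<in>topspace ?Z. c w \<le> (\<integral>x. f x \<partial>translate act g (k w))) \<and>
          (\<integral>x. f x \<partial>translate act g (k z)) < c z + e"
        by (rule below[OF f z e])
      have "continuous_map X euclideanreal (\<lambda>x. - f x)" "bounded ((\<lambda>x. - f x) ` topspace X)"
        using f by (auto intro!: continuous_map_minus simp: bounded_iff)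
      from below[OF this z e] obtain c where c: "continuous_map ?Z euclideanreal c"
          "\<forall>w\<in>topspace ?Z. c w \<le> (\<integral>x. - f x \<partial>translate act g (k w))"
          "(\<integral>x. - f x \<partial>translate act g (k z)) < c z + e"
        by blast
      show "\<exists>c. continuous_map ?Z euclideanreal c \<and>
          (\<forall>w\<in>topspace ?Z. (\<integral>x. f x \<partial>translate act g (k w)) \<le> c w) \<and>
          c z < (\<integral>x. f x \<partial>translate act g (k z)) + e"
      proof (intro exI[of _ "\<lambda>z. - c z"] conjI ballI)
        show "continuous_map ?Z euclideanreal (\<lambda>z. - c z)"
          using c(1) by (rule continuous_map_minus)
        show "- c z < (\<integral>x. f x \<partial>translate act g (k z)) + e"
          using c(3) by simp
        fix w assume w: "w \<in> topspace ?Z"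
        show "(\<integral>x. f x \<partial>translate act g (k w)) \<le> - c w"
          using bspec[OF c(2) w] by simp
      qed
    qed
  qed
  show ?thesis
    unfolding PQ_space_def[of F X] continuous_map_in_subtopology
  proof
    show "k \<in> topspace ?Z \<rightarrow> ?P" using kP(1) by blast
    show "continuous_map ?Z (tau_w F X G act) k"
    proof (rule continuous_map_into_tau_w)
      show "k z \<in> Qplus X G act" if "z \<in> topspace ?Z" for z
        using kP(1)[OF that] by (simp add: PQplus_def)
      fix f g assume f: "f \<in> Cb X F" and g: "g \<in> carrier G"
      have int: "integrable (translate act g (k z)) f" if "z \<in> topspace ?Z" for z
        using finite_measure_translate[OF action g kf[OF that]] kf(2)[OF that] f
        by (intro Cb_integrable) auto
      show "continuous_map ?Z euclidean (\<lambda>z. \<integral>x. f x \<partial>translate act g (k z))"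
      proof (rule continuous_map_complexI)
        show "continuous_map ?Z euclideanreal (\<lambda>z. Re (\<integral>x. f x \<partial>translate act g (k z)))"
          by (rule continuous_map_eq[OF real_cont[OF Cb_Re_Im(1,2)[OF f] g]]) (simp add: int)
        show "continuous_map ?Z euclideanreal (\<lambda>z. Im (\<integral>x. f x \<partial>translate act g (k z)))"
          by (rule continuous_map_eq[OF real_cont[OF Cb_Re_Im(3,4)[OF f] g]]) (simp add: int)
      qed
    qed
  qed
qed

lemma marginals_embedding:
  "embedding_map (PQ_space F X G act) (lim_PQ_space F J leq Xs p Gs as) marginals"
proof -
  let ?P = "PQplus X G act"
  let ?Z = "subtopology (lim_PQ_space F J leq Xs p Gs as) (marginals ` ?P)"
  let ?k = "inv_into ?P marginals"
  have k: "?k (marginals m) = m" if "m \<in> ?P" for m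
    using inj_marginals that by (rule inv_into_f_f)
  have "homeomorphic_maps (PQ_space F X G act) ?Z marginals ?k"
    unfolding homeomorphic_maps_def
  proof (intro conjI ballI)
    show "continuous_map (PQ_space F X G act) ?Z marginals"
      using marginals_continuous by (simp add: continuous_map_in_subtopology topspace_PQ_space)
    show "continuous_map ?Z (PQ_space F X G act) ?k"
      by (rule marginals_inverse_continuous[OF k])
  qed (auto simp: topspace_PQ_space k)
  then show ?thesis
    unfolding embedding_map_def topspace_PQ_space homeomorphic_map_maps by blast
qed

end

theorem theorem24:
  fixes F :: "complex set"
    and J :: "'i set" and leq :: "'i \<Rightarrow> 'i \<Rightarrow> bool"
    and Gs :: "'i \<Rightarrow> 'g monoid" and h :: "'i \<Rightarrow> 'i \<Rightarrow> 'g \<Rightarrow> 'g"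
    and Xs :: "'i \<Rightarrow> 'a topology" and p :: "'i \<Rightarrow> 'i \<Rightarrow> 'a \<Rightarrow> 'a"
    and as :: "'i \<Rightarrow> 'g \<Rightarrow> 'a \<Rightarrow> 'a"
    and X :: "'x topology" and \<phi> :: "'x \<Rightarrow> 'i \<Rightarrow> 'a"
    and act :: "('i \<Rightarrow> 'g) \<Rightarrow> 'x \<Rightarrow> 'x"
  defines "G \<equiv> lim_group J leq Gs h"
  assumes field: "F = \<real> \<or> F = UNIV"
    and directed: "directed_set J leq"
    and groups: "inverse_system_groups J leq Gs h"
    and spaces: "inverse_system_spaces J leq Xs p"
    and Tychonoff: "\<And>i. i \<in> J \<Longrightarrow> Tychonoff_space (Xs i)" "Tychonoff_space X"
    and actions: "\<And>i. i \<in> J \<Longrightarrow> admissible_action (Gs i) (Xs i) (as i)"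
    and equivariant: "\<And>i j g x. \<lbrakk>i \<in> J; j \<in> J; leq j i; g \<in> carrier (Gs i); x \<in> topspace (Xs i)\<rbrakk>
        \<Longrightarrow> p i j (as i g x) = as j (h i j g) (p i j x)"
    and limit: "homeomorphic_map X (lim_space J leq Xs p) \<phi>"
    and action: "admissible_action G X act"
    and compatible: "\<And>i g x. \<lbrakk>i \<in> J; g \<in> carrier G; x \<in> topspace X\<rbrakk>
        \<Longrightarrow> \<phi> (act g x) i = as i (g i) (\<phi> x i)"
    and onto: "\<And>i. i \<in> J \<Longrightarrow> (\<lambda>g. g i) ` carrier G = carrier (Gs i)"
    and radon: "\<And>i. i \<in> J \<Longrightarrow> radon_space (Xs i)"
    and countable: "countable J"
  shows "\<exists>\<Psi>. embedding_map (PQ_space F X G act) (lim_PQ_space F J leq Xs p Gs as) \<Psi>"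
proof -
  interpret inverse_limit_action J leq Xs p X \<phi> F Gs as G act
    by unfold_locales
      (fact directed spaces Tychonoff(1) limit field actions action compatible onto radon countable)+
  show ?thesis
    using marginals_embedding by blast
qed

end
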